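(* Let $\mathcal{G}=(\mathcal{T},\mathbf{A})$ denote a tree structure over a set of tasks $\mathcal{T}=\{1,\dots,k\}$ with root node $1$, given by an adjacency matrix $\mathbf{A}\in\mathbb{R}^{k\times k}$, where $\mathbf{A}_{j,l}=1$ if $j$ is the parent $pa(l)$ of $l$ and $\mathbf{A}_{j,l}=0$ otherwise (so for $l\ge 2$, $pa(l)$ is the unique node with $\mathbf{A}_{pa(l),l}=1$). Let $\boldsymbol\sigma\in\mathbb{R}^k$ be a vector with entries $\sigma_1,\dots,\sigma_k$. Let $k_{\mathbf{A},\boldsymbol\sigma}:\mathcal{T}\times\mathcal{T}\to\mathbb{R}$ be given by $k_{\mathbf{A},\boldsymbol\sigma}(t,t')=G_{t,t'}$, where $G_{i,j}$ denotes the entry at row $i$ and column $j$ of the matrix $$\mathbf{G}=(\mathbf{I}_{k\times k}-\mathbf{A})^{-1}\,\mathbf{S}\,\left(\mathbf{I}_{k\times k}-\mathbf{A}^{\mathsf T}\right)^{-1},$$ and $\mathbf{S}\in\mathbb{R}^{k\times k}$ denotes the diagonal matrix with entries $\sigma_1^2,\dots,\sigma_k^2$. Let $\boldsymbol\kappa:\mathcal{T}\times\mathcal{T}\to\mathbb{R}^{m\times m}$ be given by $\boldsymbol\kappa(t,t')=k_{\mathbf{A},\boldsymbol\sigma}(t,t')\,\mathbf{I}_{m\times m}$, and let $$p(\mathbf{y}\mid\mathbf{X},\mathbf{T};\boldsymbol\kappa)=\int p(\mathbf{y}\mid\mathbf{W},\mathbf{X})\,p(\mathbf{W}\mid\mathbf{T};\boldsymbol\kappa)\,\mathrm{d}\mathbf{W}$$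 be the marginal distribution over labels given instances and task variables defined by the varying-coefficient model with Gaussian process prior $\mathcal{GP}(\mathbf{0},\boldsymbol\kappa)$. Let $p(\mathbf{y}\mid\mathbf{X},\mathbf{T};\mathcal{G},\boldsymbol\sigma)$ be the distribution over labels defined by the hierarchical Bayesian multitask model for $(\mathcal{G},\boldsymbol\sigma)$ with the same observation model. Then it holds that $$p(\mathbf{y}\mid\mathbf{X},\mathbf{T};\boldsymbol\kappa)=p(\mathbf{y}\mid\mathbf{X},\mathbf{T};\mathcal{G},\boldsymbol\sigma).$$
   Context: Common setting: fixed instances $\mathbf{x}_1,\dots,\mathbf{x}_n\in\mathcal{X}\subseteq\mathbb{R}^m$ (rows of $\mathbf{X}$), task variables $t_1,\dots,t_n\in\mathcal{T}=\{1,\dots,k\}$ (collected in $\mathbf{T}$), a label space $\mathcal{Y}$, labels $\mathbf{y}=(y_1,\dots,y_n)\in\mathcal{Y}^n$, and an observation model, i.e. a conditional distribution $p(y\mid\mathbf{x},\mathbf{w})$ on $\mathcal{Y}$ given an instance $\mathbf{x}$ and a parameter vector $\mathbf{w}\in\mathbb{R}^m$. $\mathbf{I}_{k\times k}$ and $\mathbf{I}_{m\times m}$ denote identity matrices. Varying-coefficient model with prior $\mathcal{GP}(\mathbf{0},\boldsymbol\kappa)$: a random function $\boldsymbol\omega:\mathcal{T}\to\mathbb{R}^m$ is drawn from the zero-mean vector-valued Gaussian process with matrix-valued kernel $\boldsymbol\kappa$, i.e. finite-dimensional evaluations are jointly Gaussian with mean zero and $\boldsymbol\kappa(t,t')$ is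 the matrix of covariances between components of $\boldsymbol\omega(t)$ and $\boldsymbol\omega(t')$; put $\mathbf{w}_i=\boldsymbol\omega(t_i)$ and let $\mathbf{W}\in\mathbb{R}^{n\times m}$ have rows $\mathbf{w}_1^{\mathsf T},\dots,\mathbf{w}_n^{\mathsf T}$, with distribution $p(\mathbf{W}\mid\mathbf{T};\boldsymbol\kappa)$; given $\mathbf{W}$, labels are drawn independently as $y_i\sim p(y\mid\mathbf{x}_i,\mathbf{w}_i)$, so $p(\mathbf{y}\mid\mathbf{W},\mathbf{X})=\prod_{i=1}^n p(y_i\mid\mathbf{x}_i,\mathbf{w}_i)$. Hierarchical Bayesian multitask model for $(\mathcal{G},\boldsymbol\sigma)$: parameter vectors $\bar{\mathbf{w}}_1,\dots,\bar{\mathbf{w}}_k\in\mathbb{R}^m$ are sampled along the tree from the root, according to $\bar{\mathbf{w}}_1\sim\mathcal{N}(\mathbf{0},\sigma_1^2\mathbf{I}_{m\times m})$ and, for $2\le l\le k$, $\bar{\mathbf{w}}_l\sim\mathcal{N}(\bar{\mathbf{w}}_{pa(l)},\sigma_l^2\mathbf{I}_{m\times m})$, where $pa(l)\in\mathcal{T}$ is the unique node with $\mathbf{A}_{pa(l),l}=1$; then labels are drawn as $y_i\sim p(y\mid\mathbf{x}_i,\bar{\mathbf{w}}_{t_i})$ for $i=1,\dots,n$, with the same observation model as in the varying-coefficient model. The resulting distribution of $\mathbf{y}$ is $p(\mathbf{y}\mid\mathbf{X},\mathbf{T};\mathcal{G},\boldsymbol\sigma)$.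
   Formalization: The two inverse factors in G are interchanged, G = (I − A^T)^{-1} S (I − A)^{-1}, because with A_{j,l}=1 for j = pa(l) the printed formula fails: for two tasks with 1 the parent of 2 it gives the root variance σ_1^2+σ_2^2 instead of σ_1^2. *)

theory Defs
  imports "HOL-Probability.Probability"
begin

section \<open>Task trees and the kernel they induce\<close>

text \<open>The set of tasks is (the universe of) the finite type \<open>'k\<close>, with a distinguished root \<open>r\<close>.
  \<open>A $ j $ l = 1\<close> means that \<open>j\<close> is the parent of \<open>l\<close>. No relation between an ordering of the
  tasks and the tree is assumed.\<close>

definition rooted_tree :: "real^'k^'k \<Rightarrow> 'k \<Rightarrow> bool" where
  "rooted_tree A r \<longleftrightarrow>
     (\<forall>j l. A $ j $ l \<in> {0, 1}) \<and>
     (\<forall>j. A $ j $ r = 0) \<and>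
     (\<forall>l. l \<noteq> r \<longrightarrow> (\<exists>!j. A $ j $ l = 1)) \<and>
     (\<forall>l. (r, l) \<in> {(j, l). A $ j $ l = 1}\<^sup>*)"

definition parent :: "real^'k^'k \<Rightarrow> 'k \<Rightarrow> 'k" where
  "parent A l = (THE j. A $ j $ l = 1)"

definition depth :: "real^'k^'k \<Rightarrow> 'k \<Rightarrow> 'k \<Rightarrow> nat" where
  "depth A r l = (LEAST d. (parent A ^^ d) l = r)"

text \<open>Since \<open>A\<close> has parents as row indices, the hierarchical model reads
  \<open>w = transpose A *v w + \<epsilon>\<close> (in each component), so the factor with the transpose stands on the
  left. The formula is also found in print with the two inverses interchanged,
  \<open>G = (I - A)\<^sup>-\<^sup>1 S (I - A\<^sup>T)\<^sup>-\<^sup>1\<close>; that is correct only for the transposed adjacency matrix: for two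
  tasks with 1 the parent of 2 it would give the root the variance \<open>\<sigma>\<^sub>1\<^sup>2 + \<sigma>\<^sub>2\<^sup>2\<close> instead of
  \<open>\<sigma>\<^sub>1\<^sup>2\<close>.\<close>

definition tree_gram :: "real^'k^'k \<Rightarrow> real^'k \<Rightarrow> real^'k^'k" where
  "tree_gram A \<sigma> =
     matrix_inv (mat 1 - transpose A) ** (\<chi> i j. if i = j then (\<sigma> $ i)\<^sup>2 else 0)
       ** matrix_inv (mat 1 - A)"

definition tree_kernel :: "real^'k^'k \<Rightarrow> real^'k \<Rightarrow> 'k \<Rightarrow> 'k \<Rightarrow> real" where
  "tree_kernel A \<sigma> t t' = tree_gram A \<sigma> $ t $ t'"

definition tree_matrix_kernel ::
    "real^'k^'k \<Rightarrow> real^'k \<Rightarrow> 'k \<Rightarrow> 'k \<Rightarrow> real^'m^'m" where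
  "tree_matrix_kernel A \<sigma> t t' = tree_kernel A \<sigma> t t' *\<^sub>R mat 1"

section \<open>Gaussian processes\<close>

text \<open>Degenerate Gaussians are Gaussian throughout: kernels are only positive semidefinite,
  and noise scales may vanish.\<close>

definition gaussian_rv :: "'a measure \<Rightarrow> ('a \<Rightarrow> real) \<Rightarrow> bool" where
  "gaussian_rv M Z \<longleftrightarrow>
     Z \<in> borel_measurable M \<and>
     ((\<exists>\<mu>. AE x in M. Z x = \<mu>) \<or>
      (\<exists>\<mu> \<sigma>. \<sigma> > 0 \<and> distributed M lborel Z (normal_density \<mu> \<sigma>)))"

text \<open>\<open>P\<close> is the law, on the path space of functions \<open>'t \<Rightarrow> real^'m\<close>, of a vector-valued Gaussian
  process with mean function \<open>\<mu>\<close> and matrix-valued kernel \<open>\<kappa>\<close>. Joint Gaussianity of finitely many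
  evaluations means that every linear combination of their components is Gaussian; hence all
  expectations below are of integrable functions.\<close>

definition gaussian_process ::
    "('t \<Rightarrow> real^'m) measure \<Rightarrow> ('t \<Rightarrow> real^'m) \<Rightarrow> ('t \<Rightarrow> 't \<Rightarrow> real^'m^'m) \<Rightarrow> bool" where
  "gaussian_process P \<mu> \<kappa> \<longleftrightarrow>
     prob_space P \<and> sets P = sets (\<Pi>\<^sub>M t\<in>UNIV. borel) \<and>
     (\<forall>F a. finite F \<longrightarrow> gaussian_rv P (\<lambda>\<omega>. \<Sum>t\<in>F. a t \<bullet> \<omega> t)) \<and>
     (\<forall>t. (LINT \<omega>|P. \<omega> t) = \<mu> t) \<and>
     (\<forall>t t' i j. (LINT \<omega>|P. (\<omega> t $ i - \<mu> t $ i) * (\<omega> t' $ j - \<mu> t' $ j)) = \<kappa> t t' $ i $ j)"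

section \<open>Labels and the varying-coefficient model\<close>

text \<open>\<open>obs x w\<close> is the conditional distribution of a label given the instance \<open>x\<close> and the
  parameter vector \<open>w\<close>; row \<open>i\<close> of \<open>X\<close> and of \<open>W\<close> belong to the \<open>i\<close>-th data point. Distributions
  over label vectors are measures on the product space, so no dominating measure is needed.\<close>

definition labels_given ::
    "(real^'m \<Rightarrow> real^'m \<Rightarrow> 'y measure) \<Rightarrow> real^'m^'n \<Rightarrow> real^'m^'n \<Rightarrow> ('n \<Rightarrow> 'y) measure" where
  "labels_given obs X W = (\<Pi>\<^sub>M i\<in>UNIV. obs (X $ i) (W $ i))"

definition parameter_rows :: "('n \<Rightarrow> 'k) \<Rightarrow> ('k \<Rightarrow> real^'m) \<Rightarrow> real^'m^'n" where
  "parameter_rows t \<omega> = (\<chi> i. \<omega> (t i))"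

text \<open>Monadic bind is the mixture
  \<open>B \<mapsto> \<integral> labels_given obs X W B dp(W)\<close>, where \<open>p(W)\<close> is the image of the prior \<open>P\<close>.\<close>

definition vc_label_distribution ::
    "(real^'m \<Rightarrow> real^'m \<Rightarrow> 'y measure) \<Rightarrow> real^'m^'n \<Rightarrow> ('n \<Rightarrow> 'k) \<Rightarrow> ('k \<Rightarrow> real^'m) measure
      \<Rightarrow> ('n \<Rightarrow> 'y) measure" where
  "vc_label_distribution obs X t P =
     distr P borel (parameter_rows t) \<bind> labels_given obs X"

section \<open>The hierarchical multitask model\<close>

text \<open>The distribution \<open>N(\<mu>, \<sigma>\<^sup>2 I)\<close>, a point mass if \<open>\<sigma> = 0\<close>.\<close>

definition isotropic_normal :: "real^'m \<Rightarrow> real \<Rightarrow> (real^'m) measure" where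
  "isotropic_normal \<mu> \<sigma> =
     (if \<sigma> = 0 then return borel \<mu>
      else density lborel (\<lambda>x. ennreal
        (1 / sqrt (2 * pi * \<sigma>\<^sup>2) ^ CARD('m) * exp (- (norm (x - \<mu>))\<^sup>2 / (2 * \<sigma>\<^sup>2)))))"

text \<open>Ancestral sampling, one generation at a time: given all parameters of generations below \<open>d\<close>,
  the parameters of generation \<open>d\<close> are drawn independently, each centred at its parent's parameter
  (at 0 for the root), and all other coordinates are kept. The initial value 0 of a coordinate is
  a placeholder that is overwritten before it is read. Every depth is below \<open>CARD('k)\<close>.\<close>

definition sample_generation ::
    "real^'k^'k \<Rightarrow> 'k \<Rightarrow> real^'k \<Rightarrow> nat \<Rightarrow> ('k \<Rightarrow> real^'m) \<Rightarrow> ('k \<Rightarrow> real^'m) measure" where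
  "sample_generation A r \<sigma> d w =
     (\<Pi>\<^sub>M l\<in>UNIV.
        if depth A r l = d
        then isotropic_normal (if l = r then 0 else w (parent A l)) (\<sigma> $ l)
        else return borel (w l))"

primrec sample_generations ::
    "real^'k^'k \<Rightarrow> 'k \<Rightarrow> real^'k \<Rightarrow> nat \<Rightarrow> ('k \<Rightarrow> real^'m) measure" where
  "sample_generations A r \<sigma> 0 = return (\<Pi>\<^sub>M l\<in>UNIV. borel) (\<lambda>l. 0)"
| "sample_generations A r \<sigma> (Suc d) =
     sample_generations A r \<sigma> d \<bind> sample_generation A r \<sigma> d"

definition hierarchical_parameters ::
    "real^'k^'k \<Rightarrow> 'k \<Rightarrow> real^'k \<Rightarrow> ('k \<Rightarrow> real^'m) measure" where
  "hierarchical_parameters A r \<sigma> = sample_generations A r \<sigma> CARD('k)"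

definition hierarchical_label_distribution ::
    "(real^'m \<Rightarrow> real^'m \<Rightarrow> 'y measure) \<Rightarrow> real^'m^'n \<Rightarrow> ('n \<Rightarrow> 'k)
      \<Rightarrow> real^'k^'k \<Rightarrow> 'k \<Rightarrow> real^'k \<Rightarrow> ('n \<Rightarrow> 'y) measure" where
  "hierarchical_label_distribution obs X t A r \<sigma> =
     hierarchical_parameters A r \<sigma> \<bind> (\<lambda>w. \<Pi>\<^sub>M i\<in>UNIV. obs (X $ i) (w (t i)))"

end

theory Submission
  imports Defs
begin

text \<open>A probability measure on the path space is determined by its characteristic functional
  \<open>a \<mapsto> E exp (\<i> (\<Sum>t. a t \<bullet> \<omega> t))\<close>, and being a centred Gaussian process with kernel \<open>\<kappa>\<close> means that
  this functional is \<open>exp (- Q a / 2)\<close> with \<open>Q\<close> the quadratic form of \<open>\<kappa>\<close>. Sampling one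
  generation of the tree multiplies the functional by a Gaussian factor and replaces \<open>a\<close> by
  its image under a linear map, so ancestral sampling yields \<open>exp (- Q a / 2)\<close> with
  \<open>Q a = \<Sum>j. \<sigma>\<^sub>j\<^sup>2 |\<Sum>l. R\<^sub>l\<^sub>j a\<^sub>l|\<^sup>2\<close>, where \<open>R\<close> is the incidence matrix of the ancestor relation. Since
  \<open>R = (I - A\<^sup>T)\<^sup>-\<^sup>1\<close>, this is the quadratic form of the tree kernel: the sampled parameters are the
  Gaussian process, and the label distributions are mixtures over the same law.\<close>

section \<open>Uniqueness of characteristic functionals\<close>

text \<open>Levy's uniqueness theorem speaks about real distributions. Dividing a bounded
  nonnegative weight by its total mass and pushing forward along \<open>f\<close> yields one, which
  brings weighted integrals within its reach.\<close>

lemma reweighted_distribution: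
  fixes h f :: "'a \<Rightarrow> real"
  assumes P: "finite_measure P"
    and [measurable]: "f \<in> borel_measurable P" "h \<in> borel_measurable P"
    and h: "\<And>x. 0 \<le> h x" "\<And>x. h x \<le> C"
    and c: "(LINT x|P. h x) = c" "c \<noteq> 0"
  defines "D \<equiv> distr (density P (\<lambda>x. ennreal (h x / c))) borel f"
  shows "real_distribution D"
    and "char D s = (CLINT x|P. of_real (h x) * iexp (s * f x)) / of_real c"
    and "B \<in> sets borel \<Longrightarrow> measure D B = (LINT x|P. h x * indicator B (f x)) / c"
proof -
  interpret P: finite_measure P by fact
  have c0: "c > 0"
    using c h(1) by (metis Bochner_Integration.integral_nonneg less_eq_real_def)
  have inth: "integrable P h"
    using h by (intro P.integrable_const_bound[of _ C]) auto
  have "emeasure (density P (\<lambda>x. ennreal (h x / c))) (space P) = (\<integral>\<^sup>+x. ennreal (h x / c) \<partial>P)"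
    by (subst emeasure_density) (auto intro!: nn_integral_cong)
  also have "\<dots> = ennreal (LINT x|P. h x / c)"
    using inth h c0 by (intro nn_integral_eq_integral) auto
  also have "\<dots> = 1" using c c0 by simp
  finally have dens: "prob_space (density P (\<lambda>x. ennreal (h x / c)))"
    by (intro prob_spaceI) simp
  then interpret d: prob_space "density P (\<lambda>x. ennreal (h x / c))" .
  show R: "real_distribution D"
    unfolding D_def by (rule d.real_distribution_distr) simp
  show "char D s = (CLINT x|P. of_real (h x) * iexp (s * f x)) / of_real c"
    unfolding char_def D_def using h(1) c0
    by (simp add: integral_distr integral_density scaleR_conv_of_real flip: integral_divide_zero)
  show "measure D B = (LINT x|P. h x * indicator B (f x)) / c" if [measurable]: "B \<in> sets borel"
  proof -
    interpret D: real_distribution D by (rule R)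
    have "measure D B = (LINT x|D. indicator B x)"
      by simp
    also have "\<dots> = (LINT x|P. h x * indicator B (f x)) / c"
      unfolding D_def using h(1) c0
      by (subst integral_distr) (simp_all add: integral_density flip: integral_divide_zero)
    finally show ?thesis .
  qed
qed

text \<open>The frequency \<open>s = 0\<close> shows that both weighted measures have the same mass
  \<open>c\<close>. If \<open>c = 0\<close>, the weight vanishes almost everywhere and both sides
  are 0; otherwise the normalised distributions have equal characteristic functions.\<close>

lemma integral_nonneg_indicator_eqI:
  fixes h f :: "'a \<Rightarrow> real"
  assumes P: "finite_measure P" and Q: "finite_measure Q"
    and [measurable]: "f \<in> borel_measurable P" "h \<in> borel_measurable P"
      "f \<in> borel_measurable Q" "h \<in> borel_measurable Q"
    and h: "\<And>x. 0 \<le> h x" "\<And>x. h x \<le> C"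
    and eq: "\<And>s. (CLINT x|P. of_real (h x) * iexp (s * f x)) = (CLINT x|Q. of_real (h x) * iexp (s * f x))"
    and B[measurable]: "B \<in> sets borel"
  shows "(LINT x|P. h x * indicator B (f x)) = (LINT x|Q. h x * indicator B (f x))"
proof -
  define c where "c = (LINT x|P. h x)"
  have cP: "(LINT x|P. h x) = c" by (simp add: c_def)
  have "complex_of_real (LINT x|P. h x) = complex_of_real (LINT x|Q. h x)"
    using eq[of 0] by simp
  then have cQ: "(LINT x|Q. h x) = c" using cP by simp
  show ?thesis
  proof (cases "c = 0")
    case True
    have "(LINT x|M. h x * indicator B (f x)) = 0"
      if "finite_measure M" "(LINT x|M. h x) = 0"
        and [measurable]: "f \<in> borel_measurable M" "h \<in> borel_measurable M" for M
    proof -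
      interpret finite_measure M by fact
      have "integrable M h"
        using h by (intro integrable_const_bound[of _ C]) auto
      then have "AE x in M. h x = 0"
        using h that by (subst (asm) integral_nonneg_eq_0_iff_AE) auto
      then have "(LINT x|M. h x * indicator B (f x)) = (LINT x|M. 0)"
        by (intro integral_cong_AE) auto
      then show ?thesis by simp
    qed
    then show ?thesis using True P Q cP cQ by simp
  next
    case False
    note rP = reweighted_distribution[of P f h C c, OF P _ _ h cP False]
      and rQ = reweighted_distribution[of Q f h C c, OF Q _ _ h cQ False]
    have "distr (density P (\<lambda>x. ennreal (h x / c))) borel f
        = distr (density Q (\<lambda>x. ennreal (h x / c))) borel f"
      by (rule Levy_uniqueness) (simp_all add: rP rQ eq fun_eq_iff del: of_real_mult)
    then show ?thesis
      using rP(3)[OF _ _ B] rQ(3)[OF _ _ B] False by (simp add: field_simps)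
  qed
qed

text \<open>Dominating \<open>g\<close> by \<open>h\<close> reduces a signed weight to the nonnegative weights
  \<open>h + g\<close> and \<open>h\<close>.\<close>

lemma integral_real_indicator_eqI:
  fixes g h f :: "'a \<Rightarrow> real"
  assumes P: "finite_measure P" and Q: "finite_measure Q"
    and [measurable]: "f \<in> borel_measurable P" "h \<in> borel_measurable P" "g \<in> borel_measurable P"
      "f \<in> borel_measurable Q" "h \<in> borel_measurable Q" "g \<in> borel_measurable Q"
    and h: "\<And>x. \<bar>g x\<bar> \<le> h x" "\<And>x. h x \<le> C"
    and eqh: "\<And>s. (CLINT x|P. of_real (h x) * iexp (s * f x)) = (CLINT x|Q. of_real (h x) * iexp (s * f x))"
    and eqg: "\<And>s. (CLINT x|P. of_real (g x) * iexp (s * f x)) = (CLINT x|Q. of_real (g x) * iexp (s * f x))"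
    and B[measurable]: "B \<in> sets borel"
  shows "(LINT x|P. g x * indicator B (f x)) = (LINT x|Q. g x * indicator B (f x))"
proof -
  have gh: "0 \<le> h x" "h x \<le> C" "0 \<le> h x + g x" "h x + g x \<le> 2 * C" "\<bar>g x\<bar> \<le> C" "\<bar>h x\<bar> \<le> C" for x
    using h[of x] by linarith+
  \<comment> \<open>\<open>undefined\<close> serves as an arbitrary point of the type, at which
    \<open>C\<close> bounds an absolute value.\<close>
  have "0 \<le> C" using gh(5)[of undefined] by linarith
  have int: "integrable M (\<lambda>x. of_real (g x) * iexp (s * f x))"
    "integrable M (\<lambda>x. of_real (h x) * iexp (s * f x))"
    "integrable M (\<lambda>x. g x * indicator B (f x))"
    "integrable M (\<lambda>x. h x * indicator B (f x))"
    if "finite_measure M" and [measurable]: "f \<in> borel_measurable M" "h \<in> borel_measurable M"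
      "g \<in> borel_measurable M" for M s
    using gh \<open>0 \<le> C\<close> that
    by (auto intro!: finite_measure.integrable_const_bound[of _ _ C]
        simp: norm_mult abs_mult indicator_def)
  have "(LINT x|P. (h x + g x) * indicator B (f x)) = (LINT x|Q. (h x + g x) * indicator B (f x))"
    by (rule integral_nonneg_indicator_eqI[OF P Q, where C="2*C"])
      (simp_all add: gh int P Q eqh eqg distrib_right del: of_real_mult)
  moreover have "(LINT x|P. h x * indicator B (f x)) = (LINT x|Q. h x * indicator B (f x))"
    by (rule integral_nonneg_indicator_eqI[OF P Q _ _ _ _ gh(1,2) eqh]) auto
  ultimately show ?thesis
    using int P Q by (simp add: distrib_right)
qed

text \<open>Conjugation turns the frequency \<open>s\<close> into \<open>- s\<close>, so the
  assumption on \<open>g\<close> passes to \<open>cnj g\<close> and, by linear combination, to the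
  real and imaginary parts of \<open>g\<close>, both dominated by the same \<open>h\<close>.\<close>

lemma integral_complex_indicator_eqI:
  fixes g :: "'a \<Rightarrow> complex" and h f :: "'a \<Rightarrow> real"
  assumes P: "finite_measure P" and Q: "finite_measure Q"
    and [measurable]: "f \<in> borel_measurable P" "h \<in> borel_measurable P" "g \<in> borel_measurable P"
      "f \<in> borel_measurable Q" "h \<in> borel_measurable Q" "g \<in> borel_measurable Q"
    and h: "\<And>x. norm (g x) \<le> h x" "\<And>x. h x \<le> C"
    and eqh: "\<And>s. (CLINT x|P. of_real (h x) * iexp (s * f x)) = (CLINT x|Q. of_real (h x) * iexp (s * f x))"
    and eqg: "\<And>s. (CLINT x|P. g x * iexp (s * f x)) = (CLINT x|Q. g x * iexp (s * f x))"
    and B[measurable]: "B \<in> sets borel"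
  shows "(CLINT x|P. g x * of_real (indicator B (f x))) = (CLINT x|Q. g x * of_real (indicator B (f x)))"
proof -
  have gC: "norm (g x) \<le> C" for x using h[of x] by linarith
  have "0 \<le> C" using gC[of undefined] norm_ge_zero[of "g undefined"] by linarith
  have int: "integrable M (\<lambda>x. g x * iexp (s * f x))"
    "integrable M (\<lambda>x. g x * of_real (indicator B (f x)))"
    if "finite_measure M" and [measurable]: "f \<in> borel_measurable M" "g \<in> borel_measurable M" for M s
    using gC \<open>0 \<le> C\<close> that
    by (auto intro!: finite_measure.integrable_const_bound[of _ _ C]
        simp: norm_mult indicator_def)
  have eqc: "(CLINT x|P. cnj (g x) * iexp (s * f x)) = (CLINT x|Q. cnj (g x) * iexp (s * f x))" for s
  proof -
    have "(CLINT x|M. cnj (g x) * iexp (s * f x)) = cnj (CLINT x|M. g x * iexp (- s * f x))" for M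
      by (subst Bochner_Integration.integral_cnj[symmetric]) (simp add: exp_cnj)
    then show ?thesis
      by (simp only: eqg)
  qed
  have intc: "integrable M (\<lambda>x. cnj (g x) * iexp (s * f x))"
    if "finite_measure M" and [measurable]: "f \<in> borel_measurable M" "g \<in> borel_measurable M" for M s
    using integrable_cnj[OF int(1)[OF that, of "- s"]] by (simp add: exp_cnj del: complex_integrable_cnj)
  have eqRe: "(CLINT x|P. of_real (Re (g x)) * iexp (s * f x)) = (CLINT x|Q. of_real (Re (g x)) * iexp (s * f x))" for s
  proof -
    have "of_real (Re (g x)) * iexp (s * f x)
        = (g x * iexp (s * f x) + cnj (g x) * iexp (s * f x)) / 2" for x
      by (subst distrib_right[symmetric], subst complex_add_cnj) simp
    then show ?thesis
      by (simp only: integral_divide_zero Bochner_Integration.integral_add[OF int(1) intc] P Q assms eqg eqc)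
  qed
  have eqIm: "(CLINT x|P. of_real (Im (g x)) * iexp (s * f x)) = (CLINT x|Q. of_real (Im (g x)) * iexp (s * f x))" for s
  proof -
    have "of_real (Im (g x)) * iexp (s * f x)
        = (g x * iexp (s * f x) - cnj (g x) * iexp (s * f x)) / (2 * \<i>)" for x
      by (subst left_diff_distrib[symmetric], subst complex_diff_cnj) (simp add: field_simps)
    then show ?thesis
      by (simp only: integral_divide_zero Bochner_Integration.integral_diff[OF int(1) intc] P Q assms eqg eqc)
  qed
  have "(LINT x|P. Re (g x) * indicator B (f x)) = (LINT x|Q. Re (g x) * indicator B (f x))"
    by (rule integral_real_indicator_eqI[OF P Q, where h=h and C=C])
      (use h in \<open>auto simp: eqh eqRe simp del: of_real_mult intro: order_trans[OF abs_Re_le_cmod]\<close>)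
  moreover have "(LINT x|P. Im (g x) * indicator B (f x)) = (LINT x|Q. Im (g x) * indicator B (f x))"
    by (rule integral_real_indicator_eqI[OF P Q, where h=h and C=C])
      (use h in \<open>auto simp: eqh eqIm simp del: of_real_mult intro: order_trans[OF abs_Im_le_cmod]\<close>)
  ultimately show ?thesis
    using int(2)[OF P] int(2)[OF Q]
    by (intro complex_eqI) (simp_all flip: Bochner_Integration.integral_Re Bochner_Integration.integral_Im)
qed

text \<open>The coordinates in \<open>J\<close> have already been converted from exponentials to indicators. Each step
  of the induction converts one more, by the one-dimensional uniqueness theorem for measures
  weighted by the remaining factors.\<close>

lemma integral_prod_indicator_eqI:
  fixes f :: "'i \<Rightarrow> 'a \<Rightarrow> real"
  assumes P: "finite_measure P" and Q: "finite_measure Q" and I: "finite I"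
    and fP[measurable]: "\<And>i. i \<in> I \<Longrightarrow> f i \<in> borel_measurable P"
    and fQ[measurable]: "\<And>i. i \<in> I \<Longrightarrow> f i \<in> borel_measurable Q"
    and eq: "\<And>u. (CLINT x|P. iexp (\<Sum>i\<in>I. u i * f i x)) = (CLINT x|Q. iexp (\<Sum>i\<in>I. u i * f i x))"
    and "J \<subseteq> I" and B: "\<And>i. i \<in> I \<Longrightarrow> B i \<in> sets borel"
  shows "(CLINT x|P. of_real (\<Prod>i\<in>J. indicator (B i) (f i x)) * iexp (\<Sum>i\<in>I - J. u i * f i x))
       = (CLINT x|Q. of_real (\<Prod>i\<in>J. indicator (B i) (f i x)) * iexp (\<Sum>i\<in>I - J. u i * f i x))"
  using finite_subset[OF \<open>J \<subseteq> I\<close> I] \<open>J \<subseteq> I\<close>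
proof (induction J arbitrary: u rule: finite_induct)
  case empty
  then show ?case using eq by simp
next
  case (insert j J)
  then have j: "j \<in> I" "j \<in> I - J" "I - insert j J = (I - J) - {j}" "J \<subseteq> I" by auto
  let ?h = "\<lambda>x. (\<Prod>i\<in>J. indicator (B i) (f i x)) :: real"
  let ?g = "\<lambda>u x. of_real (?h x) * iexp (\<Sum>i\<in>(I - J) - {j}. u i * f i x)"
  have [measurable]: "?h \<in> borel_measurable M" "?g u \<in> borel_measurable M"
    if "\<And>i. i \<in> I \<Longrightarrow> f i \<in> borel_measurable M" for M u
  proof -
    have "(\<lambda>x. indicator (B i) (f i x) :: real) \<in> borel_measurable M"
      and u: "(\<lambda>x. u i * f i x) \<in> borel_measurable M" if "i \<in> I" for i
    proof -
      have [measurable]: "f i \<in> borel_measurable M" "B i \<in> sets borel"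
        using \<open>\<And>i. i \<in> I \<Longrightarrow> f i \<in> borel_measurable M\<close> B that by auto
      show "(\<lambda>x. indicator (B i) (f i x) :: real) \<in> borel_measurable M"
        and "(\<lambda>x. u i * f i x) \<in> borel_measurable M" by measurable
    qed
    then show [measurable]: "?h \<in> borel_measurable M"
      using insert.prems by (intro borel_measurable_prod) auto
    have [measurable]: "(\<lambda>x. \<Sum>i\<in>(I - J) - {j}. u i * f i x) \<in> borel_measurable M"
      using u by (intro borel_measurable_sum) auto
    show "?g u \<in> borel_measurable M"
      by measurable
  qed
  have h: "0 \<le> ?h x" "?h x \<le> 1" for x
    by (auto intro!: prod_nonneg prod_le_1)
  \<comment> \<open>Updating \<open>u\<close> at \<open>j\<close> absorbs the frequency
    \<open>s\<close> into the sum over \<open>I - J\<close>; this is why the induction hypothesis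
    must hold for all \<open>u\<close>.\<close>
  have eq': "(CLINT x|P. ?g u x * iexp (s * f j x)) = (CLINT x|Q. ?g u x * iexp (s * f j x))" for s u
  proof -
    have "?g u x * iexp (s * f j x)
        = of_real (?h x) * iexp (\<Sum>i\<in>I - J. (u(j := s)) i * f i x)" for x
    proof -
      have "(\<Sum>i\<in>I - J. (u(j := s)) i * f i x) = s * f j x + (\<Sum>i\<in>(I - J) - {j}. u i * f i x)"
        using j I by (subst sum.remove[of _ j]) (auto intro!: sum.cong)
      then show ?thesis by (simp add: distrib_left exp_add mult_ac)
    qed
    then show ?thesis using insert.IH[OF j(4), of "u(j:=s)"] by (simp only:)
  qed
  have "(CLINT x|P. ?g u x * of_real (indicator (B j) (f j x)))
      = (CLINT x|Q. ?g u x * of_real (indicator (B j) (f j x)))"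
  proof (rule integral_complex_indicator_eqI[OF P Q, where h = ?h and C = 1])
    \<comment> \<open>At frequencies 0 the exponential in \<open>?g\<close> is 1, so the same
      identity covers the dominating weight \<open>?h\<close>.\<close>
    show "(CLINT x|P. of_real (?h x) * iexp (s * f j x)) = (CLINT x|Q. of_real (?h x) * iexp (s * f j x))" for s
      using eq'[of "\<lambda>_. 0" s] by (simp del: of_real_mult of_real_prod)
  qed (use h eq' j B fP fQ in \<open>auto simp: norm_mult abs_prod simp del: of_real_mult of_real_prod of_real_sum\<close>)
  then show ?case
    using insert.hyps by (simp add: j(3) mult_ac)
qed

text \<open>Boxes form an intersection-stable generator of the product sigma algebra. The measure of
  a box is the integral of a product of indicators, and the preceding lemma with
  \<open>J = I\<close> compares these integrals.\<close>

lemma distr_PiM_eqI: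
  fixes f :: "'i \<Rightarrow> 'a \<Rightarrow> real"
  assumes P: "prob_space P" and Q: "prob_space Q" and I: "finite I"
    and fP: "\<And>i. i \<in> I \<Longrightarrow> f i \<in> borel_measurable P"
    and fQ: "\<And>i. i \<in> I \<Longrightarrow> f i \<in> borel_measurable Q"
    and eq: "\<And>u. (CLINT x|P. iexp (\<Sum>i\<in>I. u i * f i x)) = (CLINT x|Q. iexp (\<Sum>i\<in>I. u i * f i x))"
  shows "distr P (\<Pi>\<^sub>M i\<in>I. borel) (\<lambda>x. \<lambda>i\<in>I. f i x) = distr Q (\<Pi>\<^sub>M i\<in>I. borel) (\<lambda>x. \<lambda>i\<in>I. f i x)"
proof -
  interpret P: prob_space P by fact
  interpret Q: prob_space Q by fact
  let ?F = "\<lambda>x. \<lambda>i\<in>I. f i x"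
  have F: "?F \<in> P \<rightarrow>\<^sub>M (\<Pi>\<^sub>M i\<in>I. borel)" "?F \<in> Q \<rightarrow>\<^sub>M (\<Pi>\<^sub>M i\<in>I. borel)"
    using fP fQ by (auto intro!: measurable_restrict)
  interpret dP: prob_space "distr P (\<Pi>\<^sub>M i\<in>I. borel) ?F" using F by (intro P.prob_space_distr)
  show ?thesis
  proof (rule measure_eqI_PiM_finite[OF I])
    fix B :: "'i \<Rightarrow> real set" assume B: "\<And>i. i \<in> I \<Longrightarrow> B i \<in> sets borel"
    have BI: "Pi\<^sub>E I B \<in> sets (\<Pi>\<^sub>M i\<in>I. borel)"
      using B I by (intro sets_PiM_I_finite) auto
    have measure: "complex_of_real (measure (distr M (\<Pi>\<^sub>M i\<in>I. borel) ?F) (Pi\<^sub>E I B))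
        = (CLINT x|M. of_real (\<Prod>i\<in>I. indicator (B i) (f i x)))"
      if "prob_space M" and F: "?F \<in> M \<rightarrow>\<^sub>M (\<Pi>\<^sub>M i\<in>I. borel)" for M
    proof -
      interpret prob_space M by fact
      have "(\<Prod>i\<in>I. indicator (B i) (f i x)) = (indicator (?F -` Pi\<^sub>E I B) x :: real)" for x
        using I by (auto simp: indicator_def PiE_iff prod_zero_iff intro!: prod.neutral)
      then show ?thesis
        using F BI by (simp add: measure_distr Int_commute flip: of_real_prod)
    qed
    have "measure (distr P (\<Pi>\<^sub>M i\<in>I. borel) ?F) (Pi\<^sub>E I B) = measure (distr Q (\<Pi>\<^sub>M i\<in>I. borel) ?F) (Pi\<^sub>E I B)"
      using integral_prod_indicator_eqI[OF P.finite_measure_axioms Q.finite_measure_axioms I fP fQ eq subset_refl, of B "\<lambda>_. 0"]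
        measure[OF P F(1)] measure[OF Q F(2)] B
      by (simp del: of_real_prod integral_complex_of_real flip: of_real_eq_iff[where 'a = complex])
    moreover have "finite_measure (distr Q (\<Pi>\<^sub>M i\<in>I. borel) ?F)"
      by (intro Q.finite_measure_distr F)
    ultimately show "emeasure (distr P (\<Pi>\<^sub>M i\<in>I. borel) ?F) (Pi\<^sub>E I B) = emeasure (distr Q (\<Pi>\<^sub>M i\<in>I. borel) ?F) (Pi\<^sub>E I B)"
      by (simp add: dP.emeasure_eq_measure finite_measure.emeasure_eq_measure)
  next
    \<comment> \<open>The constant sequence of the whole space is the required cover by boxes of
      finite measure.\<close>
    show "range (\<lambda>_::nat. \<Pi>\<^sub>E i\<in>I. UNIV) \<subseteq> prod_algebra I (\<lambda>_. borel :: real measure)"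
      using I by (auto intro!: prod_algebraI_finite)
  qed (auto simp: space_PiM)
qed

section \<open>Laws on the path space and their linear forms\<close>

definition char_functional :: "('k::finite \<Rightarrow> 'v::real_inner) measure \<Rightarrow> ('k \<Rightarrow> 'v) \<Rightarrow> complex" where
  "char_functional P a = (CLINT \<omega>|P. iexp (\<Sum>t\<in>UNIV. a t \<bullet> \<omega> t))"

text \<open>Expanding every \<open>\<omega> t\<close> in the standard basis reduces the claim to
  finitely many real coordinates. The map \<open>g\<close> recovers the path from them and also
  turns real frequencies \<open>u\<close> into the argument \<open>g u\<close> of the
  functional.\<close>

theorem char_functional_unique:
  fixes P Q :: "('k::finite \<Rightarrow> 'v::euclidean_space) measure"
  assumes P: "prob_space P" and Q: "prob_space Q"
    and setsP [measurable_cong]: "sets P = sets (\<Pi>\<^sub>M t\<in>UNIV. borel)"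
    and setsQ [measurable_cong]: "sets Q = sets (\<Pi>\<^sub>M t\<in>UNIV. borel)"
    and eq: "\<And>a. char_functional P a = char_functional Q a"
  shows "P = Q"
proof -
  let ?I = "UNIV \<times> Basis :: ('k \<times> 'v) set"
  let ?f = "\<lambda>(t, b) \<omega>. \<omega> t \<bullet> b"
  let ?F = "\<lambda>\<omega>. \<lambda>i\<in>?I. ?f i \<omega>"
  let ?R = "\<Pi>\<^sub>M i\<in>?I. (borel :: real measure)"
  let ?E = "\<Pi>\<^sub>M t\<in>UNIV. (borel :: 'v measure)"
  define g :: "('k \<times> 'v \<Rightarrow> real) \<Rightarrow> 'k \<Rightarrow> 'v" where "g = (\<lambda>z t. \<Sum>b\<in>Basis. z (t, b) *\<^sub>R b)"
  have "(\<lambda>z. \<Sum>b\<in>Basis. z (t, b) *\<^sub>R b) \<in> ?R \<rightarrow>\<^sub>M borel" for t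
  proof (rule borel_measurable_sum)
    fix b :: 'v assume "b \<in> Basis"
    then have [measurable]: "(\<lambda>z. z (t, b)) \<in> ?R \<rightarrow>\<^sub>M borel"
      by (intro measurable_component_singleton) simp
    show "(\<lambda>z. z (t, b) *\<^sub>R b) \<in> ?R \<rightarrow>\<^sub>M borel"
      by measurable
  qed
  then have "(\<lambda>z. \<lambda>t\<in>UNIV. \<Sum>b\<in>Basis. z (t, b) *\<^sub>R b) \<in> ?R \<rightarrow>\<^sub>M ?E"
    by (rule measurable_restrict)
  then have g: "g \<in> ?R \<rightarrow>\<^sub>M ?E" by (simp add: g_def restrict_UNIV)
  have "(\<lambda>\<omega>. \<omega> t \<bullet> b) \<in> borel_measurable ?E" for t :: 'k and b :: 'v
    by measurable
  then have fm: "?f i \<in> borel_measurable P" "?f i \<in> borel_measurable Q" for i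
    unfolding measurable_cong_sets[OF setsP refl] measurable_cong_sets[OF setsQ refl]
    by (simp_all add: case_prod_unfold)
  have F: "?F \<in> P \<rightarrow>\<^sub>M ?R" "?F \<in> Q \<rightarrow>\<^sub>M ?R"
    using fm by (auto intro!: measurable_restrict)
  have gF: "g (?F \<omega>) = \<omega>" for \<omega>
    by (simp add: g_def fun_eq_iff euclidean_representation)
  have "distr P ?R ?F = distr Q ?R ?F"
  proof (rule distr_PiM_eqI[OF P Q])
    fix u :: "'k \<times> 'v \<Rightarrow> real"
    have "(\<Sum>i\<in>?I. u i * ?f i \<omega>) = (\<Sum>t\<in>UNIV. \<Sum>b\<in>Basis. u (t, b) * (b \<bullet> \<omega> t))" for \<omega>
      by (subst sum.cartesian_product) (auto intro!: sum.cong simp: inner_commute)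
    then have "(\<Sum>i\<in>?I. u i * ?f i \<omega>) = (\<Sum>t\<in>UNIV. g u t \<bullet> \<omega> t)" for \<omega>
      by (simp add: g_def inner_sum_left)
    then show "(CLINT x|P. iexp (\<Sum>i\<in>?I. u i * ?f i x)) = (CLINT x|Q. iexp (\<Sum>i\<in>?I. u i * ?f i x))"
      using eq[of "g u"] by (simp add: char_functional_def)
  qed (use fm in auto)
  then have "distr (distr P ?R ?F) ?E g = distr (distr Q ?R ?F) ?E g" by simp
  then show ?thesis
    using g F gF setsP setsQ by (simp add: distr_distr comp_def distr_id2)
qed

section \<open>Products and mixtures of probability kernels\<close>

text \<open>Boxes suffice, as they generate the product; there the measure is a finite product of
  measurable functions of the parameter. Serves both the label kernel and the sampling
  kernel.\<close>

lemma measurable_PiM_kernel: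
  fixes K :: "'i::finite \<Rightarrow> 'a \<Rightarrow> 'b measure"
  assumes K: "\<And>i. K i \<in> M \<rightarrow>\<^sub>M prob_algebra (N i)"
  shows "(\<lambda>x. \<Pi>\<^sub>M i\<in>UNIV. K i x) \<in> M \<rightarrow>\<^sub>M prob_algebra (\<Pi>\<^sub>M i\<in>UNIV. N i)"
proof -
  have Kp: "prob_space (K i x)" "sets (K i x) = sets (N i)" if "x \<in> space M" for i x
    using measurable_space[OF K that, of i] by (auto simp: space_prob_algebra)
  show ?thesis
  proof (rule measurable_prob_algebra_generated[OF sets_PiM Int_stable_prod_algebra prod_algebra_sets_into_space])
    fix x assume x: "x \<in> space M"
    interpret product_prob_space "\<lambda>i. K i x" UNIV
      using Kp[OF x] by (simp add: product_prob_space_def product_prob_space_axioms_def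
          product_sigma_finite_def prob_space_imp_sigma_finite)
    show "prob_space (\<Pi>\<^sub>M i\<in>UNIV. K i x)" by (rule P.prob_space_axioms)
    show "sets (\<Pi>\<^sub>M i\<in>UNIV. K i x) = sets (\<Pi>\<^sub>M i\<in>UNIV. N i)"
      using Kp(2)[OF x] by (intro sets_PiM_cong) auto
  next
    fix A assume "A \<in> prod_algebra UNIV N"
    then obtain E where A: "A = Pi\<^sub>E UNIV E" and E: "\<And>i. E i \<in> sets (N i)"
      by (auto elim!: prod_algebraE_all)
    have "emeasure (\<Pi>\<^sub>M i\<in>UNIV. K i x) A = (\<Prod>i\<in>UNIV. emeasure (K i x) (E i))" if x: "x \<in> space M" for x
    proof -
      interpret product_prob_space "\<lambda>i. K i x" UNIV
        using Kp[OF x] by (simp add: product_prob_space_def product_prob_space_axioms_def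
            product_sigma_finite_def prob_space_imp_sigma_finite)
      show ?thesis unfolding A using E Kp(2)[OF x] by (intro emeasure_PiM) auto
    qed
    moreover have "(\<lambda>x. \<Prod>i\<in>UNIV. emeasure (K i x) (E i)) \<in> borel_measurable M"
      using E K by (intro borel_measurable_prod_ennreal measurable_emeasure_kernel measurable_prob_algebraD)
    ultimately show "(\<lambda>x. emeasure (\<Pi>\<^sub>M i\<in>UNIV. K i x) A) \<in> borel_measurable M"
      by (simp cong: measurable_cong)
  qed
qed

text \<open>The interchange holds for the real and imaginary parts separately. The inner integral is
  bounded by \<open>B\<close>, hence integrable, so the two parts can be recombined.\<close>

lemma integral_bind_complex:
  fixes f :: "'b \<Rightarrow> complex"
  assumes [measurable]: "f \<in> borel_measurable K" and bound: "\<And>x. norm (f x) \<le> B"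
    and N: "N \<in> M \<rightarrow>\<^sub>M prob_algebra K" and M: "prob_space M"
  shows "(CLINT y|(M \<bind> N). f y) = (CLINT x|M. CLINT y|N x. f y)"
proof -
  interpret prob_space M by fact
  have N': "N \<in> M \<rightarrow>\<^sub>M subprob_algebra K" by (rule measurable_prob_algebraD[OF N])
  have Nx: "prob_space (N x)" "sets (N x) = sets K" if "x \<in> space M" for x
    using measurable_space[OF N that] by (auto simp: space_prob_algebra)
  have "space M \<noteq> {}" by (rule not_empty)
  have ib: "integrable L f" if "prob_space L" "sets L = sets K" for L
  proof -
    interpret L: prob_space L by fact
    show ?thesis
      by (rule L.integrable_const_bound[of _ B])
         (use bound that(2) assms(1) measurable_cong_sets[OF that(2) refl] in auto)
  qed
  have "prob_space (M \<bind> N)" "sets (M \<bind> N) = sets K"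
    using prob_space_bind[OF _ N'] Nx sets_bind[OF Nx(2) \<open>space M \<noteq> {}\<close>] by auto
  note i = ib[OF this]
  have Re: "(LINT y|(M \<bind> N). Re (f y)) = (LINT x|M. LINT y|N x. Re (f y))"
    by (rule integral_bind[where B=B and B'=1 and K=K])
       (use bound Nx N' in \<open>auto intro: order_trans[OF abs_Re_le_cmod] finite_measure_axioms
         simp: prob_space.emeasure_space_1\<close>)
  have Im: "(LINT y|(M \<bind> N). Im (f y)) = (LINT x|M. LINT y|N x. Im (f y))"
    by (rule integral_bind[where B=B and B'=1 and K=K])
       (use bound Nx N' in \<open>auto intro: order_trans[OF abs_Im_le_cmod] finite_measure_axioms
         simp: prob_space.emeasure_space_1\<close>)
  have m: "(\<lambda>x. CLINT y|N x. f y) \<in> borel_measurable M"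
    using measurable_compose[OF N' integral_measurable_subprob_algebra[OF assms(1)]] .
  have "norm (CLINT y|N x. f y) \<le> B" if "x \<in> space M" for x
  proof -
    interpret Nx: prob_space "N x" using Nx that by simp
    have "norm (CLINT y|N x. f y) \<le> (LINT y|N x. B)"
      using ib[OF Nx[OF that]] bound
      by (intro order_trans[OF integral_norm_bound] integral_mono integrable_norm) auto
    then show ?thesis by (simp add: Nx.prob_space)
  qed
  then have i2: "integrable M (\<lambda>x. CLINT y|N x. f y)"
    using m by (intro integrable_const_bound[of _ B]) auto
  show ?thesis
    using i i2 Re Im
    by (intro complex_eqI)
       (auto simp flip: Bochner_Integration.integral_Re Bochner_Integration.integral_Im
         intro!: Bochner_Integration.integral_cong
         simp: Bochner_Integration.integral_Re[OF ib[OF Nx]] Bochner_Integration.integral_Im[OF ib[OF Nx]])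
qed

section \<open>Normal distributions\<close>

text \<open>A normal variable is an affine image of a standard normal one, whose characteristic
  function is known.\<close>

lemma char_normal:
  assumes s: "s > 0"
  shows "char (density lborel (normal_density m s)) u = iexp (u * m) * of_real (exp (- (u * s)\<^sup>2 / 2))"
proof -
  interpret prob_space std_normal_distribution
    by (rule prob_space_normal_density) simp
  have "distributed std_normal_distribution lborel (\<lambda>x. x) std_normal_density"
    unfolding distributed_def by (simp add: distr_id2)
  from normal_density_affine[OF this, of s m] s
  have "distributed std_normal_distribution lborel (\<lambda>x. m + s * x) (normal_density m s)"
    by simp
  then have "density lborel (normal_density m s) = distr std_normal_distribution lborel (\<lambda>x. m + s * x)"
    by (simp add: distributed_distr_eq_density)
  then have "char (density lborel (normal_density m s)) u
      = (CLINT x|std_normal_distribution. iexp (u * (m + s * x)))"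
    by (simp add: char_def integral_distr)
  also have "\<dots> = (CLINT x|std_normal_distribution. iexp (u * m) * iexp (u * s * x))"
    by (intro Bochner_Integration.integral_cong) (simp_all add: distrib_left exp_add mult_ac)
  also have "\<dots> = iexp (u * m) * char std_normal_distribution (u * s)"
    unfolding char_def by (subst integral_mult_right_zero) simp
  finally show ?thesis by (simp add: char_std_normal_distribution)
qed

lemma char_return: "char (return borel m) u = iexp (u * m)"
  by (simp add: char_def integral_return)

section \<open>Real Gaussian variables, including degenerate ones\<close>

text \<open>The last claim evaluates the characteristic function at frequency 1 only: for a linear
  form, any other frequency is absorbed into the coefficients.\<close>

lemma gaussian_rv_moments:
  assumes M: "prob_space M" and Z: "gaussian_rv M Z"
  shows "integrable M Z" "integrable M (\<lambda>x. (Z x)\<^sup>2)"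
    and "(LINT x|M. Z x) = 0 \<Longrightarrow> (LINT x|M. (Z x)\<^sup>2) = v \<Longrightarrow> (CLINT x|M. iexp (Z x)) = of_real (exp (- v / 2))"
proof -
  interpret prob_space M by fact
  have [measurable]: "Z \<in> borel_measurable M" using Z by (simp add: gaussian_rv_def)
  from Z consider m where "AE x in M. Z x = m"
    | m s where "s > 0" "distributed M lborel Z (normal_density m s)"
    by (auto simp: gaussian_rv_def)
  then have "integrable M Z \<and> integrable M (\<lambda>x. (Z x)\<^sup>2) \<and>
    ((LINT x|M. Z x) = 0 \<longrightarrow> (LINT x|M. (Z x)\<^sup>2) = v \<longrightarrow> (CLINT x|M. iexp (Z x)) = of_real (exp (- v / 2)))"
  proof cases
    case 1
    have const: "integrable M (\<lambda>x. g (Z x)) \<and> integral\<^sup>L M (\<lambda>x. g (Z x)) = g m"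
      if [measurable]: "g \<in> borel_measurable borel" for g :: "real \<Rightarrow> 'b::{banach, second_countable_topology}"
    proof -
      have ae: "AE x in M. g (Z x) = g m" using 1 by eventually_elim simp
      have "integrable M (\<lambda>x. g (Z x)) \<longleftrightarrow> integrable M (\<lambda>x. g m)"
        by (rule integrable_cong_AE) (use ae in auto)
      moreover have "integral\<^sup>L M (\<lambda>x. g (Z x)) = integral\<^sup>L M (\<lambda>x. g m)"
        by (rule integral_cong_AE) (use ae in auto)
      ultimately show ?thesis by (simp add: prob_space)
    qed
    show ?thesis
      using const[of "\<lambda>x. x"] const[of "\<lambda>x. x\<^sup>2"] const[of "\<lambda>x. iexp x"] by auto
  next
    case (2 m s)
    note D = \<open>distributed M lborel Z (normal_density m s)\<close>
    have int: "integrable M (\<lambda>x. g (Z x)) \<longleftrightarrow> integrable lborel (\<lambda>x. normal_density m s x * g x)"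
      if "g \<in> borel_measurable borel" for g :: "real \<Rightarrow> real"
      using distributed_integrable[OF D, of g] that by simp
    \<comment> \<open>Expanding around \<open>m\<close> reduces the second moment to the central
      one.\<close>
    have "(\<lambda>x. normal_density m s x * x\<^sup>2)
        = (\<lambda>x. normal_density m s x * (x - m)^2 + 2 * m * (normal_density m s x * x) - m\<^sup>2 * normal_density m s x)"
      by (simp add: fun_eq_iff power2_eq_square algebra_simps)
    then have i2: "integrable lborel (\<lambda>x. normal_density m s x * x\<^sup>2)"
      using integrable_normal_moment_nz_1[OF 2(1), of m] integrable_normal_moment[OF 2(1), of m 2]
        integrable_normal_density[OF 2(1), of m]
      by (simp add: Bochner_Integration.integrable_add Bochner_Integration.integrable_diff)
    show ?thesis
    proof (intro conjI impI)
      show "integrable M Z"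
        using int[of "\<lambda>x. x"] integrable_normal_moment_nz_1[OF 2(1), of m] by simp
      show "integrable M (\<lambda>x. (Z x)\<^sup>2)"
        using int[of "\<lambda>x. x\<^sup>2"] i2 by simp
      assume m: "(LINT x|M. Z x) = 0" and v: "(LINT x|M. (Z x)\<^sup>2) = v"
      have "m = 0" using normal_distributed_expectation[OF 2] m by simp
      moreover have "s\<^sup>2 = v" using normal_distributed_variance[OF 2] m v by simp
      moreover have "(CLINT x|M. iexp (Z x)) = char (distr M lborel Z) 1"
        by (simp add: char_def integral_distr)
      ultimately show "(CLINT x|M. iexp (Z x)) = of_real (exp (- v / 2))"
        by (simp add: distributed_distr_eq_density[OF D] char_normal[OF 2(1)])
    qed
  qed
  then show "integrable M Z" "integrable M (\<lambda>x. (Z x)\<^sup>2)"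
    and "(LINT x|M. Z x) = 0 \<Longrightarrow> (LINT x|M. (Z x)\<^sup>2) = v \<Longrightarrow> (CLINT x|M. iexp (Z x)) = of_real (exp (- v / 2))"
    by auto
qed

text \<open>Levy's theorem identifies the law. The case \<open>v = 0\<close> is a point mass and is
  treated apart because the normal density needs a positive deviation.\<close>

lemma gaussian_rv_if_char:
  assumes M: "prob_space M" and [measurable]: "Z \<in> borel_measurable M" and v: "0 \<le> v"
    and char: "\<And>u. (CLINT x|M. iexp (u * Z x)) = of_real (exp (- (u\<^sup>2 * v) / 2))"
  shows "gaussian_rv M Z" "(LINT x|M. Z x) = 0" "(LINT x|M. (Z x)\<^sup>2) = v"
proof -
  interpret prob_space M by fact
  have ch: "char (distr M borel Z) = (\<lambda>u. of_real (exp (- (u\<^sup>2 * v) / 2)))"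
    by (simp add: fun_eq_iff char_def integral_distr char del: of_real_mult)
  have "gaussian_rv M Z \<and> (LINT x|M. Z x) = 0 \<and> (LINT x|M. (Z x)\<^sup>2) = v"
  proof (cases "v = 0")
    case True
    have "real_distribution (return borel (0::real))"
      by (simp add: real_distribution_def real_distribution_axioms_def prob_space_return)
    then have "distr M borel Z = return borel 0"
      by (intro Levy_uniqueness) (simp_all add: ch True char_return fun_eq_iff)
    moreover have "AE x in return borel (0::real). x = 0" by (subst AE_return) auto
    ultimately have "AE x in distr M borel Z. x = 0" by metis
    then have ae: "AE x in M. Z x = 0" by (subst (asm) AE_distr_iff) simp_all
    then have "gaussian_rv M Z" by (auto simp: gaussian_rv_def)
    moreover have "(LINT x|M. Z x) = 0" "(LINT x|M. (Z x)\<^sup>2) = 0"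
      using ae by (auto intro!: integral_eq_zero_AE)
    ultimately show ?thesis using True by simp
  next
    case False
    then have s: "sqrt v > 0" using v by simp
    have "real_distribution (density lborel (normal_density 0 (sqrt v)))"
      using prob_space_normal_density[OF s]
      by (simp add: real_distribution_def real_distribution_axioms_def)
    then have "distr M borel Z = density lborel (normal_density 0 (sqrt v))"
      by (intro Levy_uniqueness)
        (simp_all add: ch char_normal[OF s] fun_eq_iff power_mult_distrib v)
    then have D: "distributed M lborel Z (normal_density 0 (sqrt v))"
      unfolding distributed_def by (simp cong: distr_cong)
    then have "gaussian_rv M Z" using s by (auto simp: gaussian_rv_def)
    then show ?thesis
      using normal_distributed_expectation[OF s D] normal_distributed_variance[OF s D] v by simp
  qed
  then show "gaussian_rv M Z" "(LINT x|M. Z x) = 0" "(LINT x|M. (Z x)\<^sup>2) = v" by auto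
qed

section \<open>Isotropic normal distributions\<close>

text \<open>Lebesgue measure is the image of a product of one-dimensional Lebesgue measures under
  the basis expansion, so this is Fubini's theorem.\<close>

lemma integral_lborel_prod:
  fixes f :: "'a::euclidean_space \<Rightarrow> real \<Rightarrow> complex"
  assumes f: "\<And>b. b \<in> Basis \<Longrightarrow> integrable lborel (f b)"
  shows "(CLINT x|lborel. \<Prod>b\<in>Basis. f b (x \<bullet> b)) = (\<Prod>b\<in>Basis. CLINT x|lborel. f b x)"
proof -
  interpret product_sigma_finite "\<lambda>_::'a. lborel :: real measure" ..
  have [measurable]: "f b \<in> borel_measurable borel" if "b \<in> Basis" for b
    using borel_measurable_integrable[OF f[OF that]] by simp
  have "(CLINT x|lborel. \<Prod>b\<in>Basis. f b (x \<bullet> b))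
      = (CLINT z|(\<Pi>\<^sub>M b\<in>(Basis::'a set). lborel). \<Prod>b\<in>Basis. f b ((\<Sum>b\<in>Basis. z b *\<^sub>R b) \<bullet> b))"
    by (subst lborel_eq, subst integral_distr) auto
  also have "\<dots> = (CLINT z|(\<Pi>\<^sub>M b\<in>(Basis::'a set). lborel). \<Prod>b\<in>Basis. f b (z b))"
    by (simp add: inner_sum_left_Basis cong: prod.cong)
  also have "\<dots> = (\<Prod>b\<in>Basis. CLINT x|lborel. f b x)"
    using f by (intro product_integral_prod) auto
  finally show ?thesis .
qed

text \<open>The squared norm is a sum over the basis, so its exponential factorises. The absolute
  value appears because the sign of \<open>\<sigma>\<close> is unrestricted.\<close>

lemma isotropic_normal_eq_density:
  fixes \<mu> :: "real^'m"
  assumes "\<sigma> \<noteq> 0"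
  shows "isotropic_normal \<mu> \<sigma>
    = density lborel (\<lambda>x. ennreal (\<Prod>b\<in>Basis. normal_density (\<mu> \<bullet> b) \<bar>\<sigma>\<bar> (x \<bullet> b)))"
proof -
  have "(norm v)\<^sup>2 = (\<Sum>b\<in>Basis. (v \<bullet> b)\<^sup>2)" for v :: "real^'m"
    unfolding power2_norm_eq_inner by (subst euclidean_inner) (simp add: power2_eq_square)
  then have "(\<Prod>b\<in>Basis. normal_density (\<mu> \<bullet> b) \<bar>\<sigma>\<bar> (x \<bullet> b))
    = 1 / sqrt (2 * pi * \<sigma>\<^sup>2) ^ CARD('m) * exp (- (norm (x - \<mu>))\<^sup>2 / (2 * \<sigma>\<^sup>2))" for x
    by (simp add: normal_density_def prod_dividef power_one_over inner_diff_left
        sum_divide_distrib sum_negf flip: exp_sum)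
  then show ?thesis
    using assms by (simp add: isotropic_normal_def)
qed

lemma sets_isotropic_normal [simp, measurable_cong]: "sets (isotropic_normal \<mu> \<sigma>) = sets borel"
  by (simp add: isotropic_normal_def)

lemma prob_space_isotropic_normal: "prob_space (isotropic_normal (\<mu> :: real^'m) \<sigma>)"
proof (cases "\<sigma> = 0")
  case True
  then show ?thesis by (simp add: isotropic_normal_def prob_space_return)
next
  case False
  have one: "(\<integral>\<^sup>+x. ennreal (normal_density m \<bar>\<sigma>\<bar> x) \<partial>lborel) = 1" for m
    using prob_space.emeasure_space_1[OF prob_space_normal_density[of "\<bar>\<sigma>\<bar>" m]] False
    by (simp add: emeasure_density)
  have "(\<integral>\<^sup>+x. ennreal (\<Prod>b\<in>Basis. normal_density (\<mu> \<bullet> b) \<bar>\<sigma>\<bar> (x \<bullet> b)) \<partial>lborel) = 1"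
    using nn_integral_lborel_prod[of "\<lambda>b x. normal_density (\<mu> \<bullet> b) \<bar>\<sigma>\<bar> x"] one
    by (simp add: prod_ennreal)
  then show ?thesis
    unfolding isotropic_normal_eq_density[OF False]
    by (intro prob_spaceI) (simp add: emeasure_density)
qed

text \<open>The product density makes the coordinates independent, so one-dimensional characteristic
  functions multiply. The formula also covers the point mass at \<open>\<sigma> = 0\<close>.\<close>

lemma integral_iexp_isotropic_normal:
  fixes \<mu> a :: "real^'m"
  shows "(CLINT x|isotropic_normal \<mu> \<sigma>. iexp (a \<bullet> x)) = iexp (a \<bullet> \<mu>) * of_real (exp (- (\<sigma>\<^sup>2 * (norm a)\<^sup>2) / 2))"
proof (cases "\<sigma> = 0")
  case True
  then show ?thesis by (simp add: isotropic_normal_def integral_return)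
next
  case False
  let ?g = "\<lambda>b x. of_real (normal_density (\<mu> \<bullet> b) \<bar>\<sigma>\<bar> x) * iexp ((a \<bullet> b) * x)"
  have n: "(norm a)\<^sup>2 = (\<Sum>b\<in>Basis. (a \<bullet> b)\<^sup>2)"
    unfolding power2_norm_eq_inner by (subst euclidean_inner) (simp add: power2_eq_square)
  have "(CLINT x|isotropic_normal \<mu> \<sigma>. iexp (a \<bullet> x))
      = (CLINT x|lborel. of_real (\<Prod>b\<in>Basis. normal_density (\<mu> \<bullet> b) \<bar>\<sigma>\<bar> (x \<bullet> b)) * iexp (a \<bullet> x))"
    unfolding isotropic_normal_eq_density[OF False]
    by (subst integral_density) (auto simp: prod_nonneg scaleR_conv_of_real)
  also have "\<dots> = (CLINT x|lborel. \<Prod>b\<in>Basis. ?g b (x \<bullet> b))"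
  proof -
    have "iexp (a \<bullet> x) = (\<Prod>b\<in>Basis. iexp ((a \<bullet> b) * (x \<bullet> b)))" for x
      by (subst euclidean_inner) (simp add: exp_sum sum_distrib_left)
    then show ?thesis by (simp add: prod.distrib)
  qed
  also have "\<dots> = (\<Prod>b\<in>Basis. CLINT x|lborel. ?g b x)"
  proof (rule integral_lborel_prod)
    fix b :: "real^'m"
    have "integrable lborel (normal_density (\<mu> \<bullet> b) \<bar>\<sigma>\<bar>)" using False by simp
    then show "integrable lborel (?g b)"
      by (rule Bochner_Integration.integrable_bound) (auto simp: norm_mult)
  qed
  also have "\<dots> = (\<Prod>b\<in>Basis. iexp ((a \<bullet> b) * (\<mu> \<bullet> b)) * of_real (exp (- ((a \<bullet> b) * \<bar>\<sigma>\<bar>)\<^sup>2 / 2)))"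
  proof (rule prod.cong[OF refl])
    fix b :: "real^'m"
    have "(CLINT x|lborel. ?g b x) = char (density lborel (normal_density (\<mu> \<bullet> b) \<bar>\<sigma>\<bar>)) (a \<bullet> b)"
      unfolding char_def by (subst integral_density) (auto simp: scaleR_conv_of_real)
    then show "(CLINT x|lborel. ?g b x) = iexp ((a \<bullet> b) * (\<mu> \<bullet> b)) * of_real (exp (- ((a \<bullet> b) * \<bar>\<sigma>\<bar>)\<^sup>2 / 2))"
      using char_normal[of "\<bar>\<sigma>\<bar>" "\<mu> \<bullet> b" "a \<bullet> b"] False by simp
  qed
  also have "\<dots> = iexp (a \<bullet> \<mu>) * of_real (exp (- (\<sigma>\<^sup>2 * (norm a)\<^sup>2) / 2))"
  proof -
    have "(\<Prod>b\<in>Basis. iexp ((a \<bullet> b) * (\<mu> \<bullet> b))) = iexp (a \<bullet> \<mu>)"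
      by (subst (2) euclidean_inner) (simp add: exp_sum sum_distrib_left)
    moreover have "(\<Prod>b\<in>Basis. exp (- ((a \<bullet> b) * \<bar>\<sigma>\<bar>)\<^sup>2 / 2)) = exp (- (\<sigma>\<^sup>2 * (norm a)\<^sup>2) / 2)"
      by (simp add: n sum_distrib_left sum_divide_distrib sum_negf power_mult_distrib mult.commute flip: exp_sum)
    ultimately show ?thesis by (simp only: prod.distrib of_real_prod[symmetric])
  qed
  finally show ?thesis .
qed

text \<open>Translation invariance of Lebesgue measure makes every such law a translate of the
  centred one. The kernel is thus the image of a constant kernel under a jointly measurable
  map.\<close>

lemma measurable_isotropic_normal:
  fixes f :: "'a \<Rightarrow> real^'m"
  assumes [measurable]: "f \<in> borel_measurable M"
  shows "(\<lambda>x. isotropic_normal (f x) \<sigma>) \<in> M \<rightarrow>\<^sub>M prob_algebra borel"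
proof -
  have "isotropic_normal \<mu> \<sigma> = distr (isotropic_normal 0 \<sigma>) borel (\<lambda>x. \<mu> + x)" for \<mu> :: "real^'m"
  proof (cases "\<sigma> = 0")
    case True
    then show ?thesis by (simp add: isotropic_normal_def distr_return)
  next
    case False
    let ?d = "\<lambda>\<mu> x. ennreal (1 / sqrt (2 * pi * \<sigma>\<^sup>2) ^ CARD('m) * exp (- (norm (x - \<mu>))\<^sup>2 / (2 * \<sigma>\<^sup>2)))"
    have [measurable]: "?d \<mu> \<in> borel_measurable borel" for \<mu> :: "real^'m" by measurable
    have "density (distr lborel borel ((+) \<mu>)) (?d \<mu>) = distr (density lborel (\<lambda>x. ?d \<mu> (\<mu> + x))) borel ((+) \<mu>)"
      by (rule density_distr) measurable
    then show ?thesis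
      using False by (simp add: isotropic_normal_def lborel_distr_plus)
  qed
  note translate = this
  have "(\<lambda>x. distr (isotropic_normal 0 \<sigma>) borel (\<lambda>y. f x + y)) \<in> M \<rightarrow>\<^sub>M prob_algebra borel"
  proof (rule measurable_distr_prob_space2)
    show "(\<lambda>_. isotropic_normal (0::real^'m) \<sigma>) \<in> M \<rightarrow>\<^sub>M prob_algebra borel"
      by (rule measurable_const) (simp add: space_prob_algebra prob_space_isotropic_normal)
    have "(\<lambda>p. f (fst p) + snd p) \<in> borel_measurable (M \<Otimes>\<^sub>M borel)"
      by (intro borel_measurable_add measurable_compose[OF measurable_fst assms] measurable_snd)
    then show "(\<lambda>(x, y). f x + y) \<in> M \<Otimes>\<^sub>M borel \<rightarrow>\<^sub>M borel"
      by (simp add: case_prod_unfold)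
  qed
  then show ?thesis by (subst translate)
qed

section \<open>Gaussian processes with finite index set\<close>

definition covariance_form :: "('t::finite \<Rightarrow> 't \<Rightarrow> real^'m^'m) \<Rightarrow> ('t \<Rightarrow> real^'m) \<Rightarrow> real" where
  "covariance_form \<kappa> a = (\<Sum>t\<in>UNIV. \<Sum>t'\<in>UNIV. a t \<bullet> (\<kappa> t t' *v a t'))"

lemma integrable_mult_of_squares:
  fixes X Y :: "'a \<Rightarrow> real"
  assumes [measurable]: "X \<in> borel_measurable M" "Y \<in> borel_measurable M"
    and "integrable M (\<lambda>x. (X x)\<^sup>2)" "integrable M (\<lambda>x. (Y x)\<^sup>2)"
  shows "integrable M (\<lambda>x. X x * Y x)"
proof (rule Bochner_Integration.integrable_bound)
  show "integrable M (\<lambda>x. (X x)\<^sup>2 + (Y x)\<^sup>2)" using assms by simp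
  have "\<bar>X x * Y x\<bar> \<le> (X x)\<^sup>2 + (Y x)\<^sup>2" for x
    using sum_squares_bound[of "\<bar>X x\<bar>" "\<bar>Y x\<bar>"] abs_ge_zero[of "X x * Y x"]
    unfolding abs_mult power2_abs by linarith
  then show "AE x in M. norm (X x * Y x) \<le> norm ((X x)\<^sup>2 + (Y x)\<^sup>2)"
    by (intro AE_I2) (simp add: order_trans)
qed simp

text \<open>Coefficients supported at one index read off a single coordinate, which is therefore
  Gaussian and square integrable; products of two coordinates are then integrable.\<close>

lemma gaussian_linear_forms_integrable:
  fixes P :: "('t::finite \<Rightarrow> real^'m) measure"
  assumes P: "prob_space P" and G: "\<And>a. gaussian_rv P (\<lambda>\<omega>. \<Sum>t\<in>UNIV. a t \<bullet> \<omega> t)"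
  shows "integrable P (\<lambda>\<omega>. \<omega> t)" "integrable P (\<lambda>\<omega>. \<omega> t $ i * \<omega> t' $ j)"
    "(LINT \<omega>|P. \<omega> t) $ i = (LINT \<omega>|P. \<omega> t $ i)"
proof -
  have single: "(\<Sum>s\<in>UNIV. (if s = t then v else 0) \<bullet> \<omega> s) = v \<bullet> \<omega> t" for v t and \<omega> :: "'t \<Rightarrow> real^'m"
    by (simp add: if_distrib[of "\<lambda>x. x \<bullet> _"] cong: if_cong)
  have g: "gaussian_rv P (\<lambda>\<omega>. v \<bullet> \<omega> t)" for v t
    using G[of "\<lambda>s. if s = t then v else 0"] by (simp only: single)
  have i: "integrable P (\<lambda>\<omega>. v \<bullet> \<omega> t)" for v t
    by (rule gaussian_rv_moments[OF P g])
  have "integrable P (\<lambda>\<omega>. \<Sum>b\<in>Basis. (b \<bullet> \<omega> t) *\<^sub>R b)"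
    using i by (intro Bochner_Integration.integrable_sum integrable_scaleR_left) auto
  then show int: "integrable P (\<lambda>\<omega>. \<omega> t)"
    by (simp add: inner_commute[of _ "_ t"] euclidean_representation)
  have c: "axis i 1 \<bullet> \<omega> t = \<omega> t $ i" for i t and \<omega> :: "'t \<Rightarrow> real^'m"
    by (simp add: inner_axis')
  have m: "(\<lambda>\<omega>. \<omega> t $ i) \<in> borel_measurable P" "integrable P (\<lambda>\<omega>. (\<omega> t $ i)\<^sup>2)" for t i
    using g[of "axis i 1" t] gaussian_rv_moments(2)[OF P g[of "axis i 1" t]]
    by (simp_all add: gaussian_rv_def c)
  then show "integrable P (\<lambda>\<omega>. \<omega> t $ i * \<omega> t' $ j)"
    by (intro integrable_mult_of_squares)
  show "(LINT \<omega>|P. \<omega> t) $ i = (LINT \<omega>|P. \<omega> t $ i)"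
    using Bochner_Integration.integral_inner_right[of "axis i 1" P "\<lambda>\<omega>. \<omega> t"] int by (simp add: c inner_axis')
qed

section \<open>Gaussian processes characterised by their functionals\<close>

lemma linear_form_square:
  fixes \<omega> :: "'t::finite \<Rightarrow> real^'m"
  shows "(\<Sum>t\<in>UNIV. a t \<bullet> \<omega> t)\<^sup>2
    = (\<Sum>t\<in>UNIV. \<Sum>t'\<in>UNIV. \<Sum>i\<in>UNIV. \<Sum>j\<in>UNIV. a t $ i * a t' $ j * (\<omega> t $ i * \<omega> t' $ j))"
  unfolding power2_eq_square sum_product inner_vec_def
  by (intro sum.cong refl) (simp add: mult_ac)

lemma covariance_form_eq:
  "covariance_form \<kappa> a = (\<Sum>t\<in>UNIV. \<Sum>t'\<in>UNIV. \<Sum>i\<in>UNIV. \<Sum>j\<in>UNIV. a t $ i * a t' $ j * \<kappa> t t' $ i $ j)"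
  unfolding covariance_form_def inner_vec_def matrix_vector_mult_def
  by (intro sum.cong refl) (simp add: sum_distrib_left mult_ac)

text \<open>Expanding a linear form and its square gives its mean 0 and its variance
  \<open>covariance_form \<kappa> a\<close>; being Gaussian, it has no further freedom.\<close>

lemma char_functional_gaussian_process:
  fixes P :: "('t::finite \<Rightarrow> real^'m) measure"
  assumes gp: "gaussian_process P (\<lambda>_. 0) \<kappa>"
  shows "char_functional P a = of_real (exp (- covariance_form \<kappa> a / 2))"
proof -
  from gp have P: "prob_space P" and mean: "\<And>t. (LINT \<omega>|P. \<omega> t) = 0"
    and cov: "\<And>t t' i j. (LINT \<omega>|P. \<omega> t $ i * \<omega> t' $ j) = \<kappa> t t' $ i $ j"
    and g: "\<And>a. gaussian_rv P (\<lambda>\<omega>. \<Sum>t\<in>UNIV. a t \<bullet> \<omega> t)"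
    by (auto simp: gaussian_process_def)
  note int = gaussian_linear_forms_integrable[OF P g]
  have "(LINT \<omega>|P. (\<Sum>t\<in>UNIV. a t \<bullet> \<omega> t)) = 0"
    using int(1) mean by (simp add: Bochner_Integration.integral_sum)
  moreover have "(LINT \<omega>|P. (\<Sum>t\<in>UNIV. a t \<bullet> \<omega> t)\<^sup>2) = covariance_form \<kappa> a"
    unfolding linear_form_square covariance_form_eq using int(2) cov
    by (simp add: Bochner_Integration.integral_sum)
  ultimately show ?thesis
    unfolding char_functional_def by (rule gaussian_rv_moments(3)[OF P g])
qed

text \<open>Scaling \<open>a\<close> by \<open>u\<close> scales the form by the square of
  \<open>u\<close>, so the functional contains the whole characteristic function of each linear
  form, which is thus centred Gaussian. Single covariances follow by polarisation.\<close>

lemma gaussian_process_if_char_functional: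
  fixes P :: "('t::finite \<Rightarrow> real^'m) measure"
  assumes P: "prob_space P" and setsP: "sets P = sets (\<Pi>\<^sub>M t\<in>UNIV. borel)"
    and char: "\<And>a. char_functional P a = of_real (exp (- covariance_form \<kappa> a / 2))"
    and nonneg: "\<And>a. 0 \<le> covariance_form \<kappa> a"
    and sym: "\<And>t t' i j. \<kappa> t t' $ i $ j = \<kappa> t' t $ j $ i"
  shows "gaussian_process P (\<lambda>_. 0) \<kappa>"
proof -
  have "(\<lambda>\<omega>. \<Sum>t\<in>UNIV. a t \<bullet> \<omega> t) \<in> borel_measurable (\<Pi>\<^sub>M t\<in>UNIV. borel)" for a :: "'t \<Rightarrow> real^'m"
    by measurable
  then have meas: "(\<lambda>\<omega>. \<Sum>t\<in>UNIV. a t \<bullet> \<omega> t) \<in> borel_measurable P" for a :: "'t \<Rightarrow> real^'m"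
    unfolding measurable_cong_sets[OF setsP refl] .
  have "(CLINT \<omega>|P. iexp (u * (\<Sum>t\<in>UNIV. a t \<bullet> \<omega> t))) = of_real (exp (- (u\<^sup>2 * covariance_form \<kappa> a) / 2))" for u a
  proof -
    have "covariance_form \<kappa> (\<lambda>t. u *\<^sub>R a t) = u\<^sup>2 * covariance_form \<kappa> a"
      by (simp add: covariance_form_eq sum_distrib_left power2_eq_square mult_ac)
    then show ?thesis
      using char[of "\<lambda>t. u *\<^sub>R a t"] by (simp add: char_functional_def sum_distrib_left)
  qed
  note rv = gaussian_rv_if_char[OF P meas nonneg this]
  note int = gaussian_linear_forms_integrable[OF P rv(1)]
  \<comment> \<open>Test coefficients that read off coordinate \<open>i\<close> at index
    \<open>t\<close>.\<close>
  define e :: "'t \<Rightarrow> 'm \<Rightarrow> 't \<Rightarrow> real^'m" where "e t i s = (if s = t then axis i 1 else 0)" for t i s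
  have e: "(\<Sum>s\<in>UNIV. e t i s \<bullet> \<omega> s) = \<omega> t $ i" for t i \<omega>
    by (simp add: e_def if_distrib[of "\<lambda>x. x \<bullet> _"] inner_axis' cong: if_cong)
  have cov: "(LINT \<omega>|P. \<omega> t $ i * \<omega> t' $ j) = \<kappa> t t' $ i $ j" for t t' i j
  proof -
    let ?B = "\<lambda>a b. \<Sum>t\<in>UNIV. \<Sum>t'\<in>UNIV. a t \<bullet> (\<kappa> t t' *v b t')"
    have Be: "?B (e t i) (e t' j) = \<kappa> t t' $ i $ j" for t i t' j
    proof -
      have "?B (e t i) (e t' j) = e t i t \<bullet> (\<kappa> t t' *v e t' j t')"
        unfolding e_def by (simp add: if_distrib[of "\<lambda>x. x \<bullet> _"] if_distrib[of "\<lambda>x. _ *v x"]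
            if_distrib[of "\<lambda>x. _ \<bullet> x"] cong: if_cong)
      also have "\<dots> = \<kappa> t t' $ i $ j"
        by (simp add: e_def inner_axis' matrix_vector_mult_basis column_def)
      finally show ?thesis .
    qed
    \<comment> \<open>Polarisation: the two mixed terms agree by symmetry of
      \<open>\<kappa>\<close>, and the pure terms are variances.\<close>
    have "covariance_form \<kappa> (\<lambda>s. e t i s + e t' j s)
        = ?B (e t i) (e t i) + ?B (e t i) (e t' j) + ?B (e t' j) (e t i) + ?B (e t' j) (e t' j)"
      unfolding covariance_form_def
      by (simp only: matrix_vector_right_distrib inner_add_left inner_add_right sum.distrib add_ac)
    then have "(LINT \<omega>|P. (\<Sum>s\<in>UNIV. (e t i s + e t' j s) \<bullet> \<omega> s)\<^sup>2)
        = \<kappa> t t $ i $ i + 2 * \<kappa> t t' $ i $ j + \<kappa> t' t' $ j $ j"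
      unfolding rv(3) using sym[of t t' i j] by (simp add: Be)
    moreover have "(\<Sum>s\<in>UNIV. (e t i s + e t' j s) \<bullet> \<omega> s)\<^sup>2
        = \<omega> t $ i * \<omega> t $ i + 2 * (\<omega> t $ i * \<omega> t' $ j) + \<omega> t' $ j * \<omega> t' $ j" for \<omega>
      by (simp add: inner_add_left sum.distrib e power2_eq_square algebra_simps)
    moreover have sq: "(LINT \<omega>|P. \<omega> t $ i * \<omega> t $ i) = \<kappa> t t $ i $ i" for t i
      using rv(3)[of "e t i"] Be[of t i t i] by (simp add: e power2_eq_square covariance_form_def)
    ultimately show ?thesis
      using int(2) by (simp add: Bochner_Integration.integral_add)
  qed
  show ?thesis
    unfolding gaussian_process_def
  proof (intro conjI allI impI)
    fix F :: "'t set" and a :: "'t \<Rightarrow> real^'m"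
    have "(\<Sum>t\<in>UNIV. (if t \<in> F then a t else 0) \<bullet> \<omega> t) = (\<Sum>t\<in>F. a t \<bullet> \<omega> t)" for \<omega>
      by (intro sum.mono_neutral_cong_right) auto
    then show "gaussian_rv P (\<lambda>\<omega>. \<Sum>t\<in>F. a t \<bullet> \<omega> t)"
      using rv(1)[of "\<lambda>t. if t \<in> F then a t else 0"] by simp
  next
    fix t
    have "(LINT \<omega>|P. \<omega> t $ i) = 0" for i using rv(2)[of "e t i"] by (simp add: e)
    then show "(LINT \<omega>|P. \<omega> t) = 0" by (simp add: vec_eq_iff int(3))
  qed (use P setsP cov in simp_all)
qed

lemma gaussian_process_unique:
  fixes P Q :: "('t::finite \<Rightarrow> real^'m) measure"
  assumes "gaussian_process P (\<lambda>_. 0) \<kappa>" "gaussian_process Q (\<lambda>_. 0) \<kappa>"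
  shows "P = Q"
proof (rule char_functional_unique)
  show "char_functional P a = char_functional Q a" for a
    by (simp only: assms[THEN char_functional_gaussian_process])
qed (use assms in \<open>auto simp: gaussian_process_def\<close>)

section \<open>The ancestor matrix of a task tree\<close>

context
  fixes A :: "real^'k^'k" and r :: 'k
  assumes tree: "rooted_tree A r"
begin

abbreviation "edges \<equiv> {(j, l). A $ j $ l = 1}"

lemma root_has_no_parent: "A $ j $ r = 0"
  using tree by (simp add: rooted_tree_def)

text \<open>Away from the root the definite description in \<open>parent\<close> is well defined, so
  column \<open>l\<close> is a unit vector.\<close>

lemma adjacency_parent:
  assumes "l \<noteq> r"
  shows "A $ j $ l = of_bool (j = parent A l)"
proof -
  have "\<exists>!j. A $ j $ l = 1" using tree assms unfolding rooted_tree_def by blast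
  moreover from theI'[OF this] have "A $ parent A l $ l = 1" by (simp add: parent_def)
  ultimately have "A $ j $ l = 1 \<longleftrightarrow> j = parent A l" by blast
  moreover have "A $ j $ l \<in> {0, 1}" using tree unfolding rooted_tree_def by blast
  ultimately show ?thesis by auto
qed

text \<open>The last edge of a nonempty path to \<open>l\<close> can only come from
  \<open>parent A l\<close>. This recursion determines the ancestor matrix.\<close>

lemma ancestor_iff:
  "(j, l) \<in> edges\<^sup>* \<longleftrightarrow> j = l \<or> l \<noteq> r \<and> (j, parent A l) \<in> edges\<^sup>*"
proof
  assume "(j, l) \<in> edges\<^sup>*"
  then show "j = l \<or> l \<noteq> r \<and> (j, parent A l) \<in> edges\<^sup>*"
  proof (cases rule: rtranclE)
    case (step p)
    then have "l \<noteq> r" using root_has_no_parent by auto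
    then show ?thesis using step adjacency_parent[of l p] by (auto split: if_splits)
  qed simp
next
  assume "j = l \<or> l \<noteq> r \<and> (j, parent A l) \<in> edges\<^sup>*"
  then show "(j, l) \<in> edges\<^sup>*"
    using adjacency_parent[of l "parent A l"]
    by (auto intro: rtrancl_into_rtrancl)
qed

text \<open>Guarantees that the minimum in \<open>depth\<close> is taken over a nonempty
  set.\<close>

lemma parent_iterate_root: "\<exists>d. (parent A ^^ d) l = r"
proof -
  have "(r, l) \<in> edges\<^sup>*" using tree by (auto simp: rooted_tree_def)
  then show ?thesis
  proof (induction rule: rtrancl_induct)
    case base
    show ?case by (rule exI[of _ 0]) simp
  next
    case (step p l)
    then have "l \<noteq> r" using root_has_no_parent by auto
    with step have "parent A l = p" using adjacency_parent[of l p] by (auto split: if_splits)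
    with step.IH show ?case by (metis comp_apply funpow_Suc_right)
  qed
qed

lemma depth_root: "depth A r r = 0"
  unfolding depth_def by (rule Least_eq_0) simp

lemma depth_parent:
  assumes "l \<noteq> r"
  shows "depth A r l = Suc (depth A r (parent A l))"
proof -
  obtain d where "(parent A ^^ d) l = r" using parent_iterate_root by blast
  then have "(LEAST d. (parent A ^^ d) l = r) = Suc (LEAST d. (parent A ^^ Suc d) l = r)"
    using assms by (intro Least_Suc) auto
  then show ?thesis
    unfolding depth_def by (simp add: funpow_swap1)
qed

lemma depth_ancestor:
  "(j, l) \<in> edges\<^sup>* \<Longrightarrow> j = l \<or> depth A r j < depth A r l"
proof (induction "depth A r l" arbitrary: l rule: less_induct)
  case less
  show ?case
  proof (cases "j = l")
    case False
    with less.prems have "l \<noteq> r" "(j, parent A l) \<in> edges\<^sup>*"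
      using ancestor_iff by blast+
    then show ?thesis
      using less.hyps[of "parent A l"] depth_parent[of l] by auto
  qed simp
qed

text \<open>Climbing from \<open>l\<close> to the root attains every smaller depth, so there are
  more tasks than \<open>depth A r l\<close>. Hence \<open>CARD('k)\<close> rounds of sampling reach
  every task.\<close>

lemma depth_less_card: "depth A r l < CARD('k)"
proof -
  have "\<forall>l. depth A r l = d \<longrightarrow> {..d} \<subseteq> range (depth A r)" for d
  proof (induction d)
    case 0
    show ?case by auto
  next
    case (Suc d)
    show ?case
    proof (intro allI impI)
      fix l assume l: "depth A r l = Suc d"
      then have "l \<noteq> r" using depth_root by auto
      then have "depth A r (parent A l) = d" using depth_parent l by auto
      then have "{..d} \<subseteq> range (depth A r)" using Suc by blast
      moreover have "Suc d \<in> range (depth A r)" using l by (metis rangeI)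
      ultimately show "{..Suc d} \<subseteq> range (depth A r)" by (simp add: atMost_Suc)
    qed
  qed
  then have "card {..depth A r l} \<le> card (range (depth A r))"
    by (intro card_mono) auto
  also have "\<dots> \<le> CARD('k)" by (rule card_image_le) simp
  finally show ?thesis by simp
qed

section \<open>The inverse of the identity minus the transposed adjacency matrix\<close>

text \<open>Rows are tasks and columns their ancestors, each task being its own ancestor: entry
  \<open>(l, j)\<close> is the weight of the noise of \<open>j\<close> in the parameter of
  \<open>l\<close>. This is the Neumann series of \<open>transpose A\<close>.\<close>

definition ancestor_matrix :: "real^'k^'k" where
  "ancestor_matrix = (\<chi> l j. of_bool ((j, l) \<in> edges\<^sup>*))"

lemma ancestor_matrix_root: "ancestor_matrix $ r $ j = of_bool (j = r)"
  using ancestor_iff[of j r] by (simp add: ancestor_matrix_def)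

lemma ancestor_matrix_parent:
  assumes "l \<noteq> r"
  shows "ancestor_matrix $ l $ j = of_bool (j = l) + ancestor_matrix $ parent A l $ j"
proof -
  have "(l, parent A l) \<notin> edges\<^sup>*"
    using depth_ancestor[of l "parent A l"] depth_parent[OF assms] by auto
  then show ?thesis
    using ancestor_iff[of j l] assms by (auto simp: ancestor_matrix_def)
qed

lemma ancestor_matrix_depth:
  "ancestor_matrix $ l $ j \<noteq> 0 \<Longrightarrow> j = l \<or> depth A r j < depth A r l"
  using depth_ancestor[of j l] by (auto simp: ancestor_matrix_def)

text \<open>Row by row this is the parent recursion: the root's row is a unit vector, and any other
  row is its parent's row plus a unit vector.\<close>

lemma ancestor_matrix_inverse: "(mat 1 - transpose A) ** ancestor_matrix = mat 1"
proof -
  have "(\<Sum>p\<in>UNIV. (mat 1 $ l $ p - A $ p $ l) * ancestor_matrix $ p $ j) = mat 1 $ l $ j" for l j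
  proof -
    have "(\<Sum>p\<in>UNIV. (mat 1 $ l $ p - A $ p $ l) * ancestor_matrix $ p $ j)
        = ancestor_matrix $ l $ j - (\<Sum>p\<in>UNIV. A $ p $ l * ancestor_matrix $ p $ j)"
      by (simp add: left_diff_distrib sum_subtractf mat_def if_distrib[of "\<lambda>x. x * _"] cong: if_cong)
    also have "\<dots> = mat 1 $ l $ j"
    proof (cases "l = r")
      case True
      then show ?thesis by (simp add: ancestor_matrix_root root_has_no_parent mat_def)
    next
      case False
      then show ?thesis
        by (auto simp: adjacency_parent ancestor_matrix_parent[OF False] mat_def if_distrib[of "\<lambda>x. x * _"]
           of_bool_def cong: if_cong)
    qed
    finally show ?thesis .
  qed
  then show ?thesis
    by (simp add: vec_eq_iff matrix_matrix_mult_def transpose_def)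
qed

text \<open>The two inverses are the ancestor matrix and its transpose, and the middle factor is
  diagonal, which leaves a single sum.\<close>

lemma tree_gram_eq:
  "tree_gram A \<sigma> $ t $ t' = (\<Sum>j\<in>UNIV. ancestor_matrix $ t $ j * (\<sigma> $ j)\<^sup>2 * ancestor_matrix $ t' $ j)"
proof -
  \<comment> \<open>\<open>matrix_inv\<close> is a choice among two-sided inverses; for square
    matrices a one-sided inverse is two-sided, and it is the only one.\<close>
  have unique: "matrix_inv M = N" if "M ** N = mat 1" for M N :: "real^'k^'k"
  proof -
    have "M ** N = mat 1 \<and> N ** M = mat 1"
      using that by (simp add: matrix_left_right_inverse)
    then have "matrix_inv M ** M = mat 1"
      unfolding matrix_inv_def by (rule someI2) simp
    then have "matrix_inv M ** (M ** N) = N" by (simp add: matrix_mul_assoc)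
    then show ?thesis using that by simp
  qed
  have "transpose ancestor_matrix ** (mat 1 - A) = mat 1"
  proof -
    have "mat 1 - A = transpose (mat 1 - transpose A)"
      by (simp add: transpose_def vec_eq_iff mat_def)
    then show ?thesis
      by (simp add: ancestor_matrix_inverse transpose_mat flip: matrix_transpose_mul)
  qed
  then have "(mat 1 - A) ** transpose ancestor_matrix = mat 1"
    by (simp add: matrix_left_right_inverse)
  then show ?thesis
    unfolding tree_gram_def unique[OF ancestor_matrix_inverse] unique[OF \<open>(mat 1 - A) ** _ = _\<close>]
    by (simp add: matrix_matrix_mult_def transpose_def if_distrib[of "\<lambda>x. _ * x"] cong: if_cong)
qed

end

section \<open>Ancestral sampling\<close>

text \<open>Independent coordinates: the exponential of a sum factorises and Fubini's theorem
  applies.\<close>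

lemma char_functional_PiM:
  fixes K :: "'k::finite \<Rightarrow> 'v::euclidean_space measure"
  assumes K: "\<And>l. prob_space (K l)" "\<And>l. sets (K l) = sets borel"
  shows "char_functional (\<Pi>\<^sub>M l\<in>UNIV. K l) a = (\<Prod>l\<in>UNIV. CLINT x|K l. iexp (a l \<bullet> x))"
proof -
  interpret product_prob_space K UNIV
    using K by (simp add: product_prob_space_def product_prob_space_axioms_def
        product_sigma_finite_def prob_space_imp_sigma_finite)
  have "iexp (\<Sum>l\<in>UNIV. a l \<bullet> \<omega> l) = (\<Prod>l\<in>UNIV. iexp (a l \<bullet> \<omega> l))" for \<omega>
    by (simp add: sum_distrib_left exp_sum)
  moreover have "integrable (K l) (\<lambda>x. iexp (a l \<bullet> x))" for l
  proof -
    have "finite_measure (K l)" using K(1) by (simp add: prob_space_def)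
    have "(\<lambda>x. iexp (a l \<bullet> x)) \<in> borel_measurable borel" by measurable
    then have "(\<lambda>x. iexp (a l \<bullet> x)) \<in> borel_measurable (K l)"
      unfolding measurable_cong_sets[OF K(2) refl] .
    with \<open>finite_measure (K l)\<close> show ?thesis
      by (intro finite_measure.integrable_const_bound[of _ _ 1]) auto
  qed
  ultimately show ?thesis
    unfolding char_functional_def
    by (simp only:) (rule product_integral_prod[where f = "\<lambda>l x. iexp (a l \<bullet> x)", OF finite])
qed

context
  fixes A :: "real^'k^'k" and r :: 'k and \<sigma> :: "real^'k"
  assumes tree: "rooted_tree A r"
begin

section \<open>A single round of sampling\<close>

lemma measurable_sample_generation:
  "sample_generation A r \<sigma> d \<in> (\<Pi>\<^sub>M l\<in>UNIV. borel) \<rightarrow>\<^sub>M prob_algebra (\<Pi>\<^sub>M l\<in>UNIV. (borel :: (real^'m) measure))"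
proof -
  have c: "(\<lambda>w. w l) \<in> (\<Pi>\<^sub>M l\<in>UNIV. borel) \<rightarrow>\<^sub>M (borel :: (real^'m) measure)" for l
    by measurable
  have "(\<lambda>w. if depth A r l = d
      then isotropic_normal (if l = r then 0 else w (parent A l)) (\<sigma> $ l)
      else return borel (w l)) \<in> (\<Pi>\<^sub>M l\<in>UNIV. borel) \<rightarrow>\<^sub>M prob_algebra (borel :: (real^'m) measure)" for l
    using c by (cases "depth A r l = d"; cases "l = r")
      (auto intro!: measurable_isotropic_normal measurable_compose[OF c measurable_return_prob_space])
  then show ?thesis
    unfolding sample_generation_def by (rule measurable_PiM_kernel)
qed

lemma sample_generations_in_prob_algebra:
  "(sample_generations A r \<sigma> d :: ('k \<Rightarrow> real^'m) measure) \<in> space (prob_algebra (\<Pi>\<^sub>M l\<in>UNIV. borel))"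
proof (induction d)
  case 0
  show ?case by (simp add: space_prob_algebra prob_space_return space_PiM)
next
  case (Suc d)
  then show ?case
    using prob_space_bind'[OF Suc measurable_sample_generation] sets_bind'[OF Suc measurable_sample_generation]
    by (simp add: space_prob_algebra)
qed

text \<open>Transpose of the map that turns \<open>w\<close> into the mean of \<open>sample_generation A r \<sigma> d w\<close>.\<close>

definition pull_back :: "nat \<Rightarrow> ('k \<Rightarrow> real^'m) \<Rightarrow> 'k \<Rightarrow> real^'m" where
  "pull_back d a j = (if depth A r j = d then 0 else a j)
     + (\<Sum>l\<in>UNIV. if depth A r l = d \<and> l \<noteq> r \<and> parent A l = j then a l else 0)"

text \<open>Adjointness, by exchanging the sums over children and parents. The root passes no
  coefficient on, since its mean is 0.\<close>

lemma pull_back_sum: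
  "(\<Sum>j\<in>UNIV. pull_back d a j \<bullet> w j)
    = (\<Sum>l\<in>UNIV. if depth A r l = d then a l \<bullet> (if l = r then 0 else w (parent A l)) else a l \<bullet> w l)"
proof -
  have children: "(\<Sum>j\<in>UNIV. \<Sum>l\<in>UNIV. (if depth A r l = d \<and> l \<noteq> r \<and> parent A l = j then a l else 0) \<bullet> w j)
      = (\<Sum>l\<in>UNIV. if depth A r l = d then a l \<bullet> (if l = r then 0 else w (parent A l)) else 0)"
    by (subst sum.swap, intro sum.cong refl)
       (auto simp: if_distrib[of "\<lambda>x. x \<bullet> _"] if_distribR cong: if_cong)
  show ?thesis
    unfolding pull_back_def inner_add_left sum.distrib inner_sum_left children
    unfolding sum.distrib[symmetric] by (intro sum.cong refl) auto
qed

text \<open>Coordinates are drawn independently, normal in generation \<open>d\<close> and as point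
  masses elsewhere. The phases combine to the phase at the mean, and each new noise contributes a
  damping factor free of \<open>w\<close>.\<close>

lemma char_functional_sample_generation:
  "char_functional (sample_generation A r \<sigma> d w) a
    = iexp (\<Sum>j\<in>UNIV. pull_back d a j \<bullet> w j)
      * of_real (exp (- (\<Sum>l\<in>UNIV. if depth A r l = d then (\<sigma> $ l)\<^sup>2 * (norm (a l))\<^sup>2 else 0) / 2))"
proof -
  have "char_functional (sample_generation A r \<sigma> d w) a
    = (\<Prod>l\<in>UNIV. CLINT x|(if depth A r l = d
        then isotropic_normal (if l = r then 0 else w (parent A l)) (\<sigma> $ l)
        else return borel (w l)). iexp (a l \<bullet> x))"
    unfolding sample_generation_def
    by (rule char_functional_PiM) (auto simp: prob_space_isotropic_normal prob_space_return)
  also have "\<dots> = (\<Prod>l\<in>UNIV.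
      iexp (if depth A r l = d then a l \<bullet> (if l = r then 0 else w (parent A l)) else a l \<bullet> w l)
      * of_real (exp (- (if depth A r l = d then (\<sigma> $ l)\<^sup>2 * (norm (a l))\<^sup>2 else 0) / 2)))"
    by (intro prod.cong refl) (simp add: integral_iexp_isotropic_normal integral_return)
  also have "\<dots> = iexp (\<Sum>l\<in>UNIV. if depth A r l = d then a l \<bullet> (if l = r then 0 else w (parent A l)) else a l \<bullet> w l)
      * of_real (exp (\<Sum>l\<in>UNIV. - (if depth A r l = d then (\<sigma> $ l)\<^sup>2 * (norm (a l))\<^sup>2 else 0) / 2))"
    by (simp only: prod.distrib exp_sum[OF finite] of_real_sum sum_distrib_left of_real_prod)
  finally show ?thesis
    by (simp only: pull_back_sum sum_negf sum_divide_distrib[symmetric])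
qed

text \<open>If the noise of task \<open>j\<close> is \<open>\<epsilon>\<^sub>j\<close> and the coordinates of the generations from \<open>d\<close> on are
  still 0, then \<open>\<Sum>l. a l \<bullet> w l = \<Sum>j. noise_coefficient d a j \<bullet> \<epsilon>\<^sub>j\<close>.\<close>

definition noise_coefficient :: "nat \<Rightarrow> ('k \<Rightarrow> real^'m) \<Rightarrow> 'k \<Rightarrow> real^'m" where
  "noise_coefficient d a j = (\<Sum>l\<in>UNIV. if depth A r l < d then ancestor_matrix A $ l $ j *\<^sub>R a l else 0)"

text \<open>A task of depth \<open>d\<close> is no ancestor of a task of smaller depth, so its noise
  has not entered yet.\<close>

lemma noise_coefficient_generation:
  "depth A r j = d \<Longrightarrow> noise_coefficient d a j = 0"
  unfolding noise_coefficient_def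
  using ancestor_matrix_depth[OF tree] by (intro sum.neutral) fastforce

text \<open>Pulling back hands the coefficient of a generation-\<open>d\<close> task to its parent.
  By the row recursion this accounts for all its ancestors except itself; its own noise is the last
  summand.\<close>

lemma noise_coefficient_Suc:
  "noise_coefficient (Suc d) a j = noise_coefficient d (pull_back d a) j + (if depth A r j = d then a j else 0)"
proof -
  let ?R = "\<lambda>l. ancestor_matrix A $ l $ j"
  let ?\<delta> = "\<lambda>l. of_bool (j = l) :: real"
  have "(\<Sum>l\<in>UNIV. if depth A r l < d then ?R l *\<^sub>R (\<Sum>l'\<in>UNIV. if depth A r l' = d \<and> l' \<noteq> r \<and> parent A l' = l then a l' else 0) else 0)
     = (\<Sum>l\<in>UNIV. \<Sum>l'\<in>UNIV. if parent A l' = l then (if depth A r l' = d \<and> l' \<noteq> r \<and> depth A r l < d then ?R l *\<^sub>R a l' else 0) else 0)"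
    by (intro sum.cong refl) (auto simp: scaleR_sum_right intro!: sum.cong sum.neutral)
  also have "\<dots> = (\<Sum>l'\<in>UNIV. if depth A r l' = d \<and> l' \<noteq> r \<and> depth A r (parent A l') < d then ?R (parent A l') *\<^sub>R a l' else 0)"
    by (subst sum.swap) simp
  \<comment> \<open>The parent of a generation-\<open>d\<close> task has depth below
    \<open>d\<close>, so that condition drops. The root may be included because its row minus the
    unit vector is 0.\<close>
  also have "\<dots> = (\<Sum>l\<in>UNIV. if depth A r l = d then (?R l - ?\<delta> l) *\<^sub>R a l else 0)"
  proof (rule sum.cong[OF refl])
    fix l
    show "(if depth A r l = d \<and> l \<noteq> r \<and> depth A r (parent A l) < d then ?R (parent A l) *\<^sub>R a l else 0)
        = (if depth A r l = d then (?R l - ?\<delta> l) *\<^sub>R a l else 0)"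
    proof (cases "l = r")
      case True
      then show ?thesis by (simp add: ancestor_matrix_root[OF tree])
    next
      case False
      then show ?thesis
        by (simp add: ancestor_matrix_parent[OF tree False] depth_parent[OF tree False])
    qed
  qed
  finally have children: "(\<Sum>l\<in>UNIV. if depth A r l < d then ?R l *\<^sub>R (\<Sum>l'\<in>UNIV. if depth A r l' = d \<and> l' \<noteq> r \<and> parent A l' = l then a l' else 0) else 0)
     = (\<Sum>l\<in>UNIV. if depth A r l = d then (?R l - ?\<delta> l) *\<^sub>R a l else 0)" .
  have "noise_coefficient d (pull_back d a) j
      = (\<Sum>l\<in>UNIV. if depth A r l < d then ?R l *\<^sub>R a l else 0)
        + (\<Sum>l\<in>UNIV. if depth A r l = d then (?R l - ?\<delta> l) *\<^sub>R a l else 0)"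
    unfolding noise_coefficient_def pull_back_def children[symmetric] sum.distrib[symmetric]
    by (intro sum.cong refl) (auto simp: scaleR_add_right)
  moreover have "(if depth A r j = d then a j else 0) = (\<Sum>l\<in>UNIV. if depth A r l = d then ?\<delta> l *\<^sub>R a l else 0)"
  proof -
    have "(\<Sum>l\<in>UNIV. if depth A r l = d then ?\<delta> l *\<^sub>R a l else 0)
      = (\<Sum>l\<in>UNIV. if j = l then (if depth A r l = d then a l else 0) else 0)"
      by (intro sum.cong refl) auto
    then show ?thesis by simp
  qed
  ultimately show ?thesis
    unfolding noise_coefficient_def
    by (simp only: sum.distrib[symmetric]) (auto intro!: sum.cong simp: less_Suc_eq algebra_simps)
qed

text \<open>Integrating the conditional functional of the new generation over the earlier ones
  leaves the earlier functional at \<open>pull_back d a\<close>, times a constant. Hence the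
  induction runs over all \<open>a\<close>.\<close>

lemma char_functional_sample_generations:
  fixes a :: "'k \<Rightarrow> real^'m"
  shows "char_functional (sample_generations A r \<sigma> d) a
    = of_real (exp (- (\<Sum>j\<in>UNIV. (\<sigma> $ j)\<^sup>2 * (norm (noise_coefficient d a j))\<^sup>2) / 2))"
proof (induction d arbitrary: a)
  case 0
  have "(\<lambda>\<omega>. iexp (\<Sum>t\<in>UNIV. a t \<bullet> \<omega> t)) \<in> borel_measurable (\<Pi>\<^sub>M l\<in>UNIV. borel)"
    by measurable
  then have "char_functional (sample_generations A r \<sigma> 0) a = 1"
    unfolding char_functional_def sample_generations.simps
    by (subst integral_return) (auto simp: space_PiM)
  then show ?case by (simp add: noise_coefficient_def)
next
  case (Suc d)
  let ?H = "sample_generations A r \<sigma> d :: ('k \<Rightarrow> real^'m) measure"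
  have H: "prob_space ?H" "sets ?H = sets (\<Pi>\<^sub>M l\<in>UNIV. borel)"
    using sample_generations_in_prob_algebra[of d] by (auto simp: space_prob_algebra)
  have K: "sample_generation A r \<sigma> d \<in> ?H \<rightarrow>\<^sub>M prob_algebra (\<Pi>\<^sub>M l\<in>UNIV. (borel :: (real^'m) measure))"
    using measurable_sample_generation unfolding measurable_cong_sets[OF H(2) refl] .
  have meas: "(\<lambda>\<omega>. iexp (\<Sum>t\<in>UNIV. a t \<bullet> \<omega> t)) \<in> borel_measurable (\<Pi>\<^sub>M l\<in>UNIV. borel)"
    by measurable
  let ?s = "\<Sum>l\<in>UNIV. if depth A r l = d then (\<sigma> $ l)\<^sup>2 * (norm (a l))\<^sup>2 else 0"
  have "char_functional (sample_generations A r \<sigma> (Suc d)) a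
      = (CLINT w|?H. char_functional (sample_generation A r \<sigma> d w) a)"
    unfolding char_functional_def sample_generations.simps
    by (rule integral_bind_complex[OF meas _ K H(1), of 1]) simp
  also have "\<dots> = char_functional ?H (pull_back d a) * of_real (exp (- ?s / 2))"
    unfolding char_functional_sample_generation
    by (simp add: char_functional_def)
  also have "\<dots> = of_real (exp (- ((\<Sum>j\<in>UNIV. (\<sigma> $ j)\<^sup>2 * (norm (noise_coefficient d (pull_back d a) j))\<^sup>2) + ?s) / 2))"
    unfolding Suc by (simp add: exp_add[symmetric] add_divide_distrib flip: of_real_mult)
  \<comment> \<open>For each \<open>j\<close> at least one summand of
    \<open>noise_coefficient_Suc\<close> vanishes, so the squared norms add without a cross
    term.\<close>
  also have "(\<Sum>j\<in>UNIV. (\<sigma> $ j)\<^sup>2 * (norm (noise_coefficient d (pull_back d a) j))\<^sup>2) + ?s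
      = (\<Sum>j\<in>UNIV. (\<sigma> $ j)\<^sup>2 * (norm (noise_coefficient (Suc d) a j))\<^sup>2)"
    unfolding sum.distrib[symmetric]
    by (intro sum.cong refl) (auto simp: noise_coefficient_Suc noise_coefficient_generation)
  finally show ?case .
qed

text \<open>After \<open>CARD('k)\<close> rounds the depth restriction is void, and expanding the
  squared norms reproduces the entries of the Gram matrix. As a sum of squares the form is visibly
  nonnegative.\<close>

lemma covariance_form_tree:
  fixes a :: "'k \<Rightarrow> real^'m"
  shows "covariance_form (tree_matrix_kernel A \<sigma>) a
    = (\<Sum>j\<in>UNIV. (\<sigma> $ j)\<^sup>2 * (norm (noise_coefficient CARD('k) a j))\<^sup>2)"
proof -
  let ?R = "ancestor_matrix A"
  have n: "noise_coefficient CARD('k) a j = (\<Sum>l\<in>UNIV. ?R $ l $ j *\<^sub>R a l)" for j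
    by (simp add: noise_coefficient_def depth_less_card[OF tree])
  have "(\<sigma> $ j)\<^sup>2 * (norm (noise_coefficient CARD('k) a j))\<^sup>2
      = (\<Sum>t\<in>UNIV. \<Sum>t'\<in>UNIV. ?R $ t $ j * (\<sigma> $ j)\<^sup>2 * ?R $ t' $ j * (a t \<bullet> a t'))" for j
    unfolding n power2_norm_eq_inner
    by (simp add: inner_sum_left inner_sum_right sum_distrib_left mult_ac inner_commute)
  then have "(\<Sum>j\<in>UNIV. (\<sigma> $ j)\<^sup>2 * (norm (noise_coefficient CARD('k) a j))\<^sup>2)
      = (\<Sum>t\<in>UNIV. \<Sum>t'\<in>UNIV. \<Sum>j\<in>UNIV. ?R $ t $ j * (\<sigma> $ j)\<^sup>2 * ?R $ t' $ j * (a t \<bullet> a t'))"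
    by (simp only:) (subst sum.swap, subst (2) sum.swap, rule refl)
  also have "\<dots> = covariance_form (tree_matrix_kernel A \<sigma>) a"
    by (simp add: covariance_form_def tree_matrix_kernel_def tree_kernel_def tree_gram_eq[OF tree]
        scaleR_matrix_vector_assoc[symmetric] sum_distrib_right)
  finally show ?thesis by simp
qed

lemma gaussian_process_hierarchical_parameters:
  "gaussian_process (hierarchical_parameters A r \<sigma> :: ('k \<Rightarrow> real^'m) measure) (\<lambda>_. 0) (tree_matrix_kernel A \<sigma>)"
proof (rule gaussian_process_if_char_functional)
  show "prob_space (hierarchical_parameters A r \<sigma> :: ('k \<Rightarrow> real^'m) measure)"
    and "sets (hierarchical_parameters A r \<sigma> :: ('k \<Rightarrow> real^'m) measure) = sets (\<Pi>\<^sub>M l\<in>UNIV. borel)"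
    using sample_generations_in_prob_algebra[of "CARD('k)"]
    by (auto simp: hierarchical_parameters_def space_prob_algebra)
qed (simp_all add: hierarchical_parameters_def char_functional_sample_generations covariance_form_tree
      sum_nonneg tree_matrix_kernel_def tree_kernel_def tree_gram_eq[OF tree] mat_def mult_ac)

end

section \<open>Equality of the label distributions\<close>

text \<open>The existence claim keeps the universal one from being vacuous. Its witness is the law
  of the sampled parameters, and uniqueness of the process reduces every \<open>P\<close> to
  it.\<close>

theorem proposition2:
  fixes A :: "real^'k^'k" and r :: 'k and \<sigma> :: "real^'k"
    and \<X> :: "(real^'m) set" and X :: "real^'m^'n" and t :: "'n \<Rightarrow> 'k"
    and Y :: "'y measure" and obs :: "real^'m \<Rightarrow> real^'m \<Rightarrow> 'y measure"
  assumes tree: "rooted_tree A r"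
    and instances: "\<And>i. X $ i \<in> \<X>"
    and observation_model: "\<And>x. x \<in> \<X> \<Longrightarrow> obs x \<in> borel \<rightarrow>\<^sub>M prob_algebra Y"
  shows "(\<exists>P :: ('k \<Rightarrow> real^'m) measure.
            gaussian_process P (\<lambda>_. 0) (tree_matrix_kernel A \<sigma>)) \<and>
         (\<forall>P :: ('k \<Rightarrow> real^'m) measure.
            gaussian_process P (\<lambda>_. 0) (tree_matrix_kernel A \<sigma>) \<longrightarrow>
            vc_label_distribution obs X t P = hierarchical_label_distribution obs X t A r \<sigma>)"
proof (intro conjI exI allI impI)
  let ?H = "hierarchical_parameters A r \<sigma> :: ('k \<Rightarrow> real^'m) measure"
  show gp: "gaussian_process ?H (\<lambda>_. 0) (tree_matrix_kernel A \<sigma>)"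
    by (rule gaussian_process_hierarchical_parameters[OF tree])
  fix P :: "('k \<Rightarrow> real^'m) measure"
  assume "gaussian_process P (\<lambda>_. 0) (tree_matrix_kernel A \<sigma>)"
  then have "P = ?H" using gp by (rule gaussian_process_unique)
  from gp have H: "prob_space ?H" "sets ?H = sets (\<Pi>\<^sub>M l\<in>UNIV. borel)"
    by (auto simp: gaussian_process_def)
  \<comment> \<open>The matrix is written as a sum of images of its rows under the linear, hence
    Borel, maps \<open>axis i\<close>, because the target carries the Borel sets of a Euclidean
    space and not a product sigma algebra.\<close>
  have rows: "parameter_rows t \<in> ?H \<rightarrow>\<^sub>M (borel :: (real^'m^'n) measure)"
  proof -
    have "(\<lambda>\<omega>. \<chi> i. \<omega> (t i)) = (\<lambda>\<omega>. \<Sum>i\<in>UNIV. axis i (\<omega> (t i)) :: real^'m^'n)"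
      by (simp add: fun_eq_iff vec_eq_iff axis_def)
    moreover have "(\<lambda>\<omega>. axis i (\<omega> (t i)) :: real^'m^'n) \<in> (\<Pi>\<^sub>M l\<in>UNIV. borel) \<rightarrow>\<^sub>M borel" for i
    proof -
      have "linear (axis i :: real^'m \<Rightarrow> real^'m^'n)"
        by (rule linearI) (auto simp: axis_def vec_eq_iff)
      then have [measurable]: "(axis i :: real^'m \<Rightarrow> real^'m^'n) \<in> borel \<rightarrow>\<^sub>M borel"
        by (intro borel_measurable_continuous_onI linear_continuous_on linear_conv_bounded_linear[THEN iffD1])
      show ?thesis by measurable
    qed
    ultimately show ?thesis
      unfolding parameter_rows_def measurable_cong_sets[OF H(2) refl]
      by (simp add: borel_measurable_sum)
  qed
  have "(\<lambda>W. obs (X $ i) (W $ i)) \<in> (borel :: (real^'m^'n) measure) \<rightarrow>\<^sub>M prob_algebra Y" for i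
    by (rule measurable_compose[OF _ observation_model[OF instances]])
       (intro borel_measurable_continuous_onI continuous_intros)
  then have "labels_given obs X \<in> borel \<rightarrow>\<^sub>M prob_algebra (\<Pi>\<^sub>M i\<in>UNIV. Y)"
    unfolding labels_given_def by (rule measurable_PiM_kernel)
  \<comment> \<open>Mixing over an image measure is mixing over the original measure with the kernel
    composed with the map.\<close>
  then have "vc_label_distribution obs X t ?H = ?H \<bind> (\<lambda>w. labels_given obs X (parameter_rows t w))"
    unfolding vc_label_distribution_def
    by (intro bind_distr[OF rows] measurable_prob_algebraD prob_space.not_empty H)
  also have "\<dots> = hierarchical_label_distribution obs X t A r \<sigma>"
    by (simp add: hierarchical_label_distribution_def labels_given_def parameter_rows_def)
  finally show "vc_label_distribution obs X t P = hierarchical_label_distribution obs X t A r \<sigma>"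
    using \<open>P = ?H\<close> by simp
qed

end
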